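(* Let $\times\in\mathscr{P}(2,2)$ be the partition with blocks $\{1,2'\},\{2,1'\}$; let $r_1\in\mathscr{P}(2,2)$ have blocks $\{1,2'\},\{2\},\{1'\}$; let $r_2\in\mathscr{P}(2,2)$ have blocks $\{2,1'\},\{1\},\{2'\}$; and let $s\in\mathscr{P}(2,2)$ be the partition into four singletons. Then the linear category of partitions $$\mathscr{K}:=\Big\langle \times-\tfrac{2}{\delta}(r_1+r_2)+\tfrac{4}{\delta^2}\,s\Big\rangle_\delta$$ is isomorphic to $\langle\times\rangle_\delta$ for every $\delta\in\mathbb{C}$, $\delta\neq 0$. Consequently, $\mathscr{K}$ is a non-easy category.
   Context: For $k,l\in\mathbb{N}_0$ let $\mathscr{P}(k,l)$ be the set of set partitions of $k$ upper points $1,\dots,k$ and $l$ lower points $1',\dots,l'$ (both ordered left to right). For $\delta\in\mathbb{C}$ let $\mathbf{Part}_\delta(k,l)$ be the complex vector space with basis $\mathscr{P}(k,l)$. Category operations: (i) tensor product $p\otimes q$: place $p$ and $q$ side by side ($p$ on the left), extended bilinearly; (ii) composition: for $p\in\mathscr{P}(k,l)$, $q\in\mathscr{P}(l,m)$, identify the lower points of $p$ with the upper points of $q$, let $r\in\mathscr{P}(k,m)$ be the induced partition on the upper points of $p$ and lower points of $q$, and put $qp=\delta^{c}r$, where $c$ is the number of connected components consisting only of middle points; extended bilinearly; (iii) involution $p\mapsto p^*$: interchange the upper and lower rows, extended antilinearly. A linear category of partitions is a collection of subspaces $\mathscr{K}(k,l)\subseteq\mathbf{Part}_\delta(k,l)$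 containing the identity partition $\{1,1'\}\in\mathscr{P}(1,1)$ and the pair partition $\{1',2'\}\in\mathscr{P}(0,2)$ and closed under the category operations. $\langle p_1,\dots,p_n\rangle_\delta$ is the smallest linear category of partitions containing $p_1,\dots,p_n$. $\mathscr{K}$ is easy if for all $k,l$ there is a set $\mathscr{C}(k,l)\subseteq\mathscr{P}(k,l)$ with $\mathscr{K}(k,l)=\operatorname{span}\mathscr{C}(k,l)$; otherwise non-easy. Isomorphic means: there is a monoidal $*$-isomorphism, i.e. a family of linear bijections between the morphism spaces with the same $(k,l)$, compatible with tensor product, composition and involution. (The category $\langle\times\rangle_\delta$ is the span of all partitions all of whose blocks have size two.)
   Formalization: For non-real δ with the antilinear involution both claims are false (K(2,2) has dimension at least 4, and K is easy); proved instead: the antilinear involution for every real δ ≠ 0, and the linear extension of the involution for every complex δ ≠ 0. *)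

theory Defs
  imports Complex_Main "HOL-Library.Disjoint_Sets" "HOL-Library.Poly_Mapping"
begin

section \<open>Set partitions of two rows of points\<close>

datatype point = Upper nat | Lower nat

type_synonym spart = "point set set"

definition points :: "nat \<Rightarrow> nat \<Rightarrow> point set" where
  "points k l = Upper ` {1..k} \<union> Lower ` {1..l}"

definition parts :: "nat \<Rightarrow> nat \<Rightarrow> spart set" where
  "parts k l = {p. partition_on (points k l) p}"

definition id_part :: spart where
  "id_part = {{Upper 1, Lower 1}}"

definition pair_part :: spart where
  "pair_part = {{Lower 1, Lower 2}}"

definition cross_part :: spart where
  "cross_part = {{Upper 1, Lower 2}, {Upper 2, Lower 1}}"

definition r1_part :: spart where
  "r1_part = {{Upper 1, Lower 2}, {Upper 2}, {Lower 1}}"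

definition r2_part :: spart where
  "r2_part = {{Upper 2, Lower 1}, {Upper 1}, {Lower 2}}"

definition s_part :: spart where
  "s_part = {{Upper 1}, {Upper 2}, {Lower 1}, {Lower 2}}"

section \<open>Operations on partitions\<close>

primrec shift_point :: "nat \<Rightarrow> nat \<Rightarrow> point \<Rightarrow> point" where
  "shift_point k l (Upper i) = Upper (k + i)"
| "shift_point k l (Lower i) = Lower (l + i)"

text \<open>\<open>k\<close> and \<open>l\<close> are the numbers of upper and lower points of the left factor \<open>p\<close>.\<close>

definition tensor_part :: "nat \<Rightarrow> nat \<Rightarrow> spart \<Rightarrow> spart \<Rightarrow> spart" where
  "tensor_part k l p q = p \<union> (\<lambda>B. shift_point k l ` B) ` q"

primrec flip_point :: "point \<Rightarrow> point" where
  "flip_point (Upper i) = Lower i"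
| "flip_point (Lower i) = Upper i"

definition star_part :: "spart \<Rightarrow> spart" where
  "star_part p = (\<lambda>B. flip_point ` B) ` p"

text \<open>
  To compose \<open>p\<close> (from \<open>k\<close> to \<open>l\<close> points) with \<open>q\<close> (from \<open>l\<close> to \<open>m\<close> points), the lower points
  of \<open>p\<close> and the upper points of \<open>q\<close> are identified in the middle row of a three-row diagram.
  Arguments are in the order of the product \<open>q p\<close>.
\<close>

datatype point3 = Top nat | Mid nat | Bot nat

definition stacked :: "spart \<Rightarrow> spart \<Rightarrow> point3 set set" where
  "stacked q p = (\<lambda>B. case_point Top Mid ` B) ` p \<union> (\<lambda>B. case_point Mid Bot ` B) ` q"

definition components :: "spart \<Rightarrow> spart \<Rightarrow> point3 set set" where
  "components q p = \<Union> (stacked q p) // (\<Union>B\<in>stacked q p. B \<times> B)\<^sup>+"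

definition comp_part :: "spart \<Rightarrow> spart \<Rightarrow> spart" where
  "comp_part q p = (\<lambda>X. case_point Top Bot -` X) ` components q p - {{}}"

definition loops :: "spart \<Rightarrow> spart \<Rightarrow> nat" where
  "loops q p = card {X \<in> components q p. X \<subseteq> range Mid}"

section \<open>Linear combinations of set partitions\<close>

type_synonym lpart = "spart \<Rightarrow>\<^sub>0 complex"

abbreviation basis :: "spart \<Rightarrow> lpart" where
  "basis p \<equiv> Poly_Mapping.single p 1"

definition pscale :: "complex \<Rightarrow> lpart \<Rightarrow> lpart" where
  "pscale c x = Poly_Mapping.map ((*) c) x"

lemma lookup_pscale [simp]: "Poly_Mapping.lookup (pscale c x) p = c * Poly_Mapping.lookup x p"
  by (simp add: pscale_def Poly_Mapping.map.rep_eq when_def)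

lemma vector_space_pscale: "vector_space pscale"
  by unfold_locales (auto intro!: poly_mapping_eqI simp: lookup_add algebra_simps)

definition Part :: "nat \<Rightarrow> nat \<Rightarrow> lpart set" where
  "Part k l = {x. Poly_Mapping.keys x \<subseteq> parts k l}"

definition tensor :: "nat \<Rightarrow> nat \<Rightarrow> lpart \<Rightarrow> lpart \<Rightarrow> lpart" where
  "tensor k l x y =
    (\<Sum>p\<in>Poly_Mapping.keys x. \<Sum>q\<in>Poly_Mapping.keys y.
      Poly_Mapping.single (tensor_part k l p q)
        (Poly_Mapping.lookup x p * Poly_Mapping.lookup y q))"

definition compose_lin :: "complex \<Rightarrow> lpart \<Rightarrow> lpart \<Rightarrow> lpart" where
  "compose_lin \<delta> y x =
    (\<Sum>q\<in>Poly_Mapping.keys y. \<Sum>p\<in>Poly_Mapping.keys x.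
      Poly_Mapping.single (comp_part q p)
        (Poly_Mapping.lookup y q * Poly_Mapping.lookup x p * \<delta> ^ loops q p))"

text \<open>
  The involution is extended from set partitions \<open>\<sigma>\<close>-semilinearly, where \<open>\<sigma>\<close> is \<open>cnj\<close> (the
  antilinear extension) or \<open>id\<close> (the linear extension).  The rule \<open>(q p)\<^sup>* = p\<^sup>* q\<^sup>*\<close> holds
  exactly if \<open>\<sigma> \<delta> = \<delta>\<close>; for the antilinear extension this forces \<open>\<delta>\<close> to be real.
\<close>

definition star :: "(complex \<Rightarrow> complex) \<Rightarrow> lpart \<Rightarrow> lpart" where
  "star \<sigma> x =
    (\<Sum>p\<in>Poly_Mapping.keys x. Poly_Mapping.single (star_part p) (\<sigma> (Poly_Mapping.lookup x p)))"

section \<open>Linear categories of partitions\<close>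

definition linear_category ::
  "(complex \<Rightarrow> complex) \<Rightarrow> complex \<Rightarrow> (nat \<Rightarrow> nat \<Rightarrow> lpart set) \<Rightarrow> bool" where
  "linear_category \<sigma> \<delta> K \<longleftrightarrow>
    (\<forall>k l. module.subspace pscale (K k l) \<and> K k l \<subseteq> Part k l) \<and>
    basis id_part \<in> K 1 1 \<and>
    basis pair_part \<in> K 0 2 \<and>
    (\<forall>k l k' l'. \<forall>x\<in>K k l. \<forall>y\<in>K k' l'. tensor k l x y \<in> K (k + k') (l + l')) \<and>
    (\<forall>k l m. \<forall>x\<in>K k l. \<forall>y\<in>K l m. compose_lin \<delta> y x \<in> K k m) \<and>
    (\<forall>k l. \<forall>x\<in>K k l. star \<sigma> x \<in> K l k)"

text \<open>A generator is given as \<open>(k, l, x)\<close> with \<open>x \<in> Part k l\<close>.\<close>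

definition generated ::
  "(complex \<Rightarrow> complex) \<Rightarrow> complex \<Rightarrow> (nat \<times> nat \<times> lpart) set \<Rightarrow> nat \<Rightarrow> nat \<Rightarrow> lpart set" where
  "generated \<sigma> \<delta> G k l =
    \<Inter> {K k l | K. linear_category \<sigma> \<delta> K \<and> (\<forall>(a, b, x)\<in>G. x \<in> K a b)}"

definition easy :: "(nat \<Rightarrow> nat \<Rightarrow> lpart set) \<Rightarrow> bool" where
  "easy K \<longleftrightarrow> (\<forall>k l. \<exists>C \<subseteq> parts k l. K k l = module.span pscale (basis ` C))"

definition monoidal_star_iso ::
  "(complex \<Rightarrow> complex) \<Rightarrow> complex \<Rightarrow> (nat \<Rightarrow> nat \<Rightarrow> lpart set) \<Rightarrow> (nat \<Rightarrow> nat \<Rightarrow> lpart set) \<Rightarrow>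
    (nat \<Rightarrow> nat \<Rightarrow> lpart \<Rightarrow> lpart) \<Rightarrow> bool" where
  "monoidal_star_iso \<sigma> \<delta> K L \<Phi> \<longleftrightarrow>
    (\<forall>k l. bij_betw (\<Phi> k l) (K k l) (L k l)) \<and>
    (\<forall>k l. \<forall>x\<in>K k l. \<forall>y\<in>K k l. \<Phi> k l (x + y) = \<Phi> k l x + \<Phi> k l y) \<and>
    (\<forall>k l c. \<forall>x\<in>K k l. \<Phi> k l (pscale c x) = pscale c (\<Phi> k l x)) \<and>
    (\<forall>k l k' l'. \<forall>x\<in>K k l. \<forall>y\<in>K k' l'.
      \<Phi> (k + k') (l + l') (tensor k l x y) = tensor k l (\<Phi> k l x) (\<Phi> k' l' y)) \<and>
    (\<forall>k l m. \<forall>x\<in>K k l. \<forall>y\<in>K l m.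
      \<Phi> k m (compose_lin \<delta> y x) = compose_lin \<delta> (\<Phi> l m y) (\<Phi> k l x)) \<and>
    (\<forall>k l. \<forall>x\<in>K k l. \<Phi> l k (star \<sigma> x) = star \<sigma> (\<Phi> k l x))"

definition isomorphic ::
  "(complex \<Rightarrow> complex) \<Rightarrow> complex \<Rightarrow> (nat \<Rightarrow> nat \<Rightarrow> lpart set) \<Rightarrow> (nat \<Rightarrow> nat \<Rightarrow> lpart set) \<Rightarrow> bool" where
  "isomorphic \<sigma> \<delta> K L \<longleftrightarrow> (\<exists>\<Phi>. monoidal_star_iso \<sigma> \<delta> K L \<Phi>)"

end

theory Submission
  imports Defs
begin

text \<open>
  Let \<open>P\<close> be \<open>1 / \<delta>\<close> times the partition of one upper and one lower point into singletons; it is a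
  projection, and \<open>\<tau> = 1 - 2 P\<close> is a reflection with square root \<open>\<rho> = 1 + (\<i> - 1) P\<close>, whose inverse is
  \<open>1 + (- \<i> - 1) P\<close>.  Conjugation \<open>\<Phi>\<close> by \<open>\<rho> \<otimes> \<rho>\<^sup>-\<^sup>1 \<otimes> \<rho> \<otimes> \<dots>\<close> respects composition.
  It puts \<open>\<tau>\<close> on a string of a pair partition whenever the string crosses an odd number of others, so it fixes the identity and
  the pair partition and sends the crossing to the generator of \<open>K\<close>.  On the morphisms between
  rows of equal parity that are invariant under \<open>\<tau>\<close> on all strands it is an involution compatible with tensor products and \<open>*\<close>;
  these morphisms form a linear category containing the crossing, so \<open>\<Phi>\<close> exchanges the two generated
  categories.  If \<open>K\<close> were easy, it would contain the crossing, and applying \<open>\<Phi>\<close> would put the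
  generator of \<open>K\<close>, which involves singletons, into the category generated by the crossing; but there
  all blocks have even size.
\<close>

section \<open>Isolating a point of a partition\<close>

text \<open>On diagrams this cuts the strand at \<open>x\<close>, the combinatorial part of
  composing with \<open>P\<close>. Dropping \<open>{}\<close> covers the case where
  \<open>{x}\<close> is already a block.\<close>

definition isolate :: "'a \<Rightarrow> 'a set set \<Rightarrow> 'a set set" where
  "isolate x P = insert {x} ((\<lambda>B. B - {x}) ` P - {{}})"

lemma singleton_in_isolate [simp]: "{x} \<in> isolate x P"
  by (simp add: isolate_def)

lemma empty_notin_isolate [simp]: "{} \<notin> isolate x P"
  by (auto simp: isolate_def)

lemma in_isolate_iff: "B \<in> isolate x P \<longleftrightarrow> B = {x} \<or> (B \<noteq> {} \<and> (\<exists>B'\<in>P. B = B' - {x}))"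
  by (auto simp: isolate_def)

lemma isolate_trivial:
  assumes "partition_on A P" "{x} \<in> P"
  shows "isolate x P = P"
proof -
  have *: "B - {x} = B" if "B \<in> P" "B \<noteq> {x}" for B
    using disjointD[OF partition_onD2[OF assms(1)] that(1) assms(2) that(2)] by simp
  have "{} \<notin> P" using partition_onD3[OF assms(1)] .
  show ?thesis
  proof (rule set_eqI)
    fix B
    show "B \<in> isolate x P \<longleftrightarrow> B \<in> P"
      using *[of B] * \<open>{} \<notin> P\<close> assms(2) unfolding in_isolate_iff
      by (cases "B = {x}") (simp, metis Diff_cancel)
  qed
qed

lemma partition_on_isolate:
  assumes P: "partition_on A P" and x: "x \<in> A"
  shows "partition_on A (isolate x P)"
proof (rule partition_onI)
  show "\<Union> (isolate x P) = A"
    using partition_onD1[OF P] x by (auto simp: isolate_def)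
  show "disjnt p q" if pq: "p \<in> isolate x P" "q \<in> isolate x P" "p \<noteq> q" for p q
  proof (cases "p = {x} \<or> q = {x}")
    case True
    then show ?thesis using pq(1,2) \<open>p \<noteq> q\<close> by (auto simp: in_isolate_iff disjnt_def)
  next
    case False
    then obtain p' q' where "p' \<in> P" "p = p' - {x}" "q' \<in> P" "q = q' - {x}"
      using pq(1,2) unfolding in_isolate_iff by blast
    moreover from this have "p' \<inter> q' = {}"
      using disjointD[OF partition_onD2[OF P]] \<open>p \<noteq> q\<close> by metis
    ultimately show ?thesis by (auto simp: disjnt_def)
  qed
qed simp

text \<open>The right-hand side is symmetric in \<open>x\<close> and \<open>y\<close>, which yields
  commutation of isolations.\<close>

lemma isolate_isolate:
  assumes "x \<noteq> y"
  shows "isolate x (isolate y P) = insert {x} (insert {y} ((\<lambda>B. B - {x, y}) ` P - {{}}))"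
proof -
  have drop: "(\<lambda>B. B - {x}) ` (Q - {{}}) - {{}} = (\<lambda>B. B - {x}) ` Q - {{}}" for Q by auto
  have "B - {y} - {x} = B - {x, y}" for B by auto
  then have "(\<lambda>B. B - {x}) ` (\<lambda>B. B - {y}) ` P = (\<lambda>B. B - {x, y}) ` P"
    by (simp add: image_image)
  moreover have "{y} - {x} = {y}" using assms by auto
  ultimately show ?thesis
    using drop[of "(\<lambda>B. B - {y}) ` P"] by (simp add: isolate_def insert_Diff_if)
qed

lemma isolate_commute: "isolate x (isolate y P) = isolate y (isolate x P)"
  by (cases "x = y") (simp_all add: isolate_isolate insert_commute)

text \<open>A new singleton arises only when the partner in a two-element block is cut off; this
  case decides how the scalar factors of two isolations interact.\<close>

lemma singleton_in_isolate_iff: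
  assumes "partition_on A P" "x \<in> A" "x \<noteq> y"
  shows "{x} \<in> isolate y P \<longleftrightarrow> {x} \<in> P \<or> {x, y} \<in> P"
proof -
  have "B = {x} \<or> B = {x, y}" if "{x} = B - {y}" for B using that assms(3) by blast
  moreover have "{x, y} - {y} = {x}" "{x} - {y} = {x}" using assms(3) by auto
  ultimately show ?thesis
    using assms(3) unfolding in_isolate_iff by (metis insert_not_empty singleton_inject)
qed

lemma isolate_Un_disjoint:
  assumes "x \<notin> \<Union>Q" "{} \<notin> Q"
  shows "isolate x (P \<union> Q) = isolate x P \<union> Q"
proof -
  have "(\<lambda>B. B - {x}) ` Q = Q"
    using assms(1) by (intro image_cong[where g="\<lambda>B. B" and M=Q, THEN trans]) auto
  then show ?thesis using assms(2) by (auto simp: isolate_def image_Un)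
qed

lemma isolate_image:
  assumes "inj f"
  shows "isolate (f x) ((`) f ` P) = (`) f ` isolate x P"
proof -
  have "f ` B - {f x} = f ` (B - {x})" for B using assms by (simp add: image_set_diff)
  then have "(\<lambda>B. B - {f x}) ` (`) f ` P = (`) f ` (\<lambda>B. B - {x}) ` P"
    by (simp add: image_image)
  moreover have "(`) f ` Q - {{}} = (`) f ` (Q - {{}})" for Q by blast
  ultimately show ?thesis by (simp add: isolate_def)
qed

section \<open>Connected components\<close>

text \<open>The construction behind \<open>components\<close> for an arbitrary family of possibly
  overlapping blocks, so that isolation can be studied away from the three-row diagram.\<close>

definition comps :: "'a set set \<Rightarrow> 'a set set" where
  "comps S = \<Union>S // (\<Union>B\<in>S. B \<times> B)\<^sup>+"

lemma equiv_trancl_blocks: "equiv (\<Union>S) ((\<Union>B\<in>S. B \<times> B)\<^sup>+)"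
proof (rule equivI)
  show "(\<Union>B\<in>S. B \<times> B)\<^sup>+ \<subseteq> \<Union>S \<times> \<Union>S" by (rule trancl_subset_Sigma) auto
  show "refl_on (\<Union>S) ((\<Union>B\<in>S. B \<times> B)\<^sup>+)" by (auto simp: refl_on_def)
  show "sym ((\<Union>B\<in>S. B \<times> B)\<^sup>+)" by (rule sym_trancl) (auto simp: sym_def)
qed (rule trans_trancl)

lemma partition_on_comps: "partition_on (\<Union>S) (comps S)"
  unfolding comps_def by (rule partition_on_quotient[OF equiv_trancl_blocks])

lemma comps_block:
  assumes "B \<in> S" "X \<in> comps S" "B \<inter> X \<noteq> {}"
  shows "B \<subseteq> X"
proof -
  let ?R = "(\<Union>B\<in>S. B \<times> B)\<^sup>+"
  obtain a where a: "X = ?R `` {a}" using assms(2) by (auto simp: comps_def elim: quotientE)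
  obtain b where b: "b \<in> B" "(a, b) \<in> ?R" using assms(3) a by auto
  show ?thesis
  proof
    fix c assume "c \<in> B"
    then have "(b, c) \<in> ?R" using b(1) assms(1) by auto
    with b(2) show "c \<in> X" using a by (auto intro: trancl_trans)
  qed
qed

lemma quotient_isolate:
  assumes "equiv A R" "x \<in> A"
  shows "A // (R - {x} \<times> UNIV - UNIV \<times> {x} \<union> {(x, x)}) = isolate x (A // R)" (is "A // ?R' = _")
proof -
  have x: "?R' `` {x} = {x}" by auto
  have a: "?R' `` {a} = R `` {a} - {x}" if "a \<noteq> x" for a using that by auto
  show ?thesis
  proof (intro set_eqI iffI)
    fix X assume "X \<in> A // ?R'"
    then obtain a where "X = ?R' `` {a}" "a \<in> A" by (rule quotientE)
    then show "X \<in> isolate x (A // R)"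
      using x a[of a] assms(1) unfolding in_isolate_iff
      by (cases "a = x") (auto intro!: bexI[OF _ quotientI] dest: equiv_class_self)
  next
    fix X assume "X \<in> isolate x (A // R)"
    then consider "X = {x}" | Y where "X \<noteq> {}" "Y \<in> A // R" "X = Y - {x}"
      unfolding in_isolate_iff by blast
    then show "X \<in> A // ?R'"
    proof cases
      case 1
      then show ?thesis using x quotientI[OF assms(2), of ?R'] by simp
    next
      case 2
      then obtain b where b: "b \<in> Y" "b \<noteq> x" by blast
      obtain a where "Y = R `` {a}" "a \<in> A" using 2(2) by (rule quotientE)
      then have "Y = R `` {b}" using b assms(1)
        by (metis Image_singleton_iff equiv_class_eq)
      moreover have "b \<in> A" using b 2(2) assms(1) in_quotient_imp_subset by fastforce
      ultimately show ?thesis using a[OF b(2)] 2(3) quotientI[of b A ?R'] by simp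
    qed
  qed
qed

text \<open>A path through \<open>x\<close> enters and leaves it inside \<open>B\<close>, the only
  block at \<open>x\<close> besides possibly \<open>{x}\<close>, so it can be shortened within
  \<open>B - {x}\<close>. The exceptional block \<open>{x}\<close> is allowed because a middle point
  may already be isolated on one side.\<close>

lemma comps_isolate:
  assumes B: "B \<in> S" "x \<in> B" and uniq: "\<And>B'. B' \<in> S \<Longrightarrow> x \<in> B' \<Longrightarrow> B' = B \<or> B' = {x}"
  shows "comps (isolate x S) = isolate x (comps S)"
proof -
  let ?E = "\<Union>B\<in>S. B \<times> B" and ?E' = "\<Union>B\<in>isolate x S. B \<times> B"
  let ?R = "?E\<^sup>+ - {x} \<times> UNIV - UNIV \<times> {x} \<union> {(x, x)}"
  have U: "\<Union> (isolate x S) = \<Union>S" using B by (auto simp: isolate_def)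
  have E': "?E' = insert (x, x) (\<Union>B\<in>S. (B - {x}) \<times> (B - {x}))"
    by (auto simp: isolate_def)
  \<comment> \<open>The induction on paths must also cover a path that currently ends at
    \<open>x\<close>: then every other point of \<open>B\<close> is already reachable while avoiding
    \<open>x\<close>.\<close>
  have key: "(b \<noteq> x \<longrightarrow> (a, b) \<in> ?E'\<^sup>+) \<and> (b = x \<longrightarrow> (\<forall>c\<in>B - {x}. (a, c) \<in> ?E'\<^sup>+))"
    if "(a, b) \<in> ?E\<^sup>+" "a \<noteq> x" for a b
    using that(1)
  proof (induction rule: trancl_induct)
    case (base b)
    then obtain B0 where B0: "B0 \<in> S" "a \<in> B0" "b \<in> B0" by auto
    show ?case
    proof (cases "b = x")
      case True
      then have "B0 = B" using uniq B0 that(2) by blast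
      then show ?thesis using B0 True that(2) by (auto simp: E' intro!: r_into_trancl)
    next
      case False
      then show ?thesis using B0 that(2) by (auto simp: E' intro!: r_into_trancl)
    qed
  next
    case (step b c)
    then obtain B0 where B0: "B0 \<in> S" "b \<in> B0" "c \<in> B0" by auto
    consider "b = x" "c = x" | "b = x" "c \<noteq> x" | "b \<noteq> x" "c = x" | "b \<noteq> x" "c \<noteq> x" by blast
    then show ?case
    proof cases
      case 1
      then show ?thesis using step.IH by simp
    next
      case 2
      then have "B0 = B" using uniq B0 by blast
      then show ?thesis using step.IH 2 B0 by simp
    next
      case 3
      then have "B0 = B" using uniq B0 by blast
      then have "(b, d) \<in> ?E'" if "d \<in> B - {x}" for d
        using that 3 B0 by (auto simp: E')
      then show ?thesis using step.IH 3 by (meson trancl.trancl_into_trancl)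
    next
      case 4
      then have "(b, c) \<in> ?E'" using B0 by (auto simp: E')
      then show ?thesis using step.IH 4 by (meson trancl.trancl_into_trancl)
    qed
  qed
  have "?E'\<^sup>+ \<subseteq> ?R"
  proof -
    have "?E' \<subseteq> ?R" by (auto simp: E')
    moreover have "trans ?R"
    proof (rule transI)
      fix a b c assume "(a, b) \<in> ?R" "(b, c) \<in> ?R"
      then show "(a, c) \<in> ?R" by (auto intro: trancl_trans)
    qed
    ultimately show ?thesis using trancl_mono_subset[of ?E' ?R] by simp
  qed
  moreover have "?R \<subseteq> ?E'\<^sup>+"
  proof
    fix z assume "z \<in> ?R"
    then consider "z = (x, x)" | a b where "z = (a, b)" "(a, b) \<in> ?E\<^sup>+" "a \<noteq> x" "b \<noteq> x"
      by (cases z) auto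
    then show "z \<in> ?E'\<^sup>+"
    proof cases
      case 1
      then show ?thesis by (auto simp: E')
    next
      case 2
      then show ?thesis using key by blast
    qed
  qed
  ultimately have R: "?E'\<^sup>+ = ?R" by blast
  have "x \<in> \<Union>S" using B by blast
  then show ?thesis
    unfolding comps_def U R by (rule quotient_isolate[OF equiv_trancl_blocks])
qed

text \<open>If \<open>X\<close> is not a singleton, it is replaced by \<open>{x}\<close> and
  \<open>X - {x}\<close>. The number of classes inside \<open>M\<close> then rises by one if at
  least one piece lies in \<open>M\<close>: from one to two if both do, from zero to one if only one
  does.\<close>

lemma card_isolate_subsets:
  assumes C: "partition_on A C" "finite A" and x: "x \<in> X" "X \<in> C"
  shows "card {Y \<in> isolate x C. Y \<subseteq> M} = card {Y \<in> C. Y \<subseteq> M} +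
    (if X \<noteq> {x} \<and> (x \<in> M \<or> X - {x} \<subseteq> M) then 1 else 0)"
proof (cases "X = {x}")
  case True
  then show ?thesis using isolate_trivial[OF C(1)] x by simp
next
  case False
  have other: "x \<notin> Y" if "Y \<in> C" "Y \<noteq> X" for Y
    using partition_onD2[OF C(1)] that x by (auto simp: disjoint_def)
  have iso: "isolate x C = insert {x} (insert (X - {x}) (C - {X}))"
  proof (rule set_eqI)
    fix Y
    have "Y - {x} = Y" if "Y \<in> C" "Y \<noteq> X" for Y using other[OF that] by simp
    moreover have "{} \<notin> C" using partition_onD3[OF C(1)] .
    moreover have "X - {x} \<noteq> {}" using False x by blast
    ultimately show "Y \<in> isolate x C \<longleftrightarrow> Y \<in> insert {x} (insert (X - {x}) (C - {X}))"
      using x(2) unfolding in_isolate_iff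
      by (smt (verit, ccfv_threshold) Diff_iff insert_iff singletonD)
  qed
  have fin: "finite C" using finite_elements[OF C(2,1)] .
  have "disjnt (X - {x}) Y" if "Y \<in> C" "Y \<noteq> X" for Y
    using partition_onD2[OF C(1)] that x by (auto simp: disjoint_def disjnt_def)
  moreover have ne: "X - {x} \<noteq> {}" using False x by blast
  ultimately have n1: "X - {x} \<notin> C - {X}" by (metis Diff_iff disjnt_self_iff_empty insertCI)
  have n2: "{x} \<notin> C - {X}" using other by blast
  have n3: "{x} \<noteq> X - {x}" by blast
  let ?D = "{Y \<in> C - {X}. Y \<subseteq> M}"
  have e1: "{Y \<in> isolate x C. Y \<subseteq> M} =
      (if x \<in> M then {{x}} else {}) \<union> (if X - {x} \<subseteq> M then {X - {x}} else {}) \<union> ?D"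
    unfolding iso by auto
  have e2: "{Y \<in> C. Y \<subseteq> M} = (if X \<subseteq> M then {X} else {}) \<union> ?D" using x by auto
  have "finite ?D" using fin by auto
  then show ?thesis
    unfolding e1 e2 using n1 n2 n3 False x(1) by auto
qed

lemma isolate_Un: "isolate x (P \<union> Q) = isolate x P \<union> isolate x Q"
  by (auto simp: isolate_def)

text \<open>A block \<open>{x}\<close> makes isolation of \<open>x\<close> trivial on
  \<open>S\<close>, so \<open>comps_isolate\<close> exhibits \<open>{x}\<close> as a component;
  conversely a component contains every block that it meets.\<close>

lemma singleton_in_comps_iff:
  assumes B: "B \<in> S" "x \<in> B" and uniq: "\<And>B'. B' \<in> S \<Longrightarrow> x \<in> B' \<Longrightarrow> B' = B \<or> B' = {x}"
    and "{} \<notin> S"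
  shows "{x} \<in> comps S \<longleftrightarrow> B = {x}"
proof
  assume "{x} \<in> comps S"
  then have "B \<subseteq> {x}" using comps_block[OF B(1)] B(2) by blast
  then show "B = {x}" using B(2) by blast
next
  assume "B = {x}"
  then have "S = {{x}} \<union> (S - {{x}})" "x \<notin> \<Union> (S - {{x}})" "{} \<notin> S - {{x}}"
    using B uniq \<open>{} \<notin> S\<close> by blast+
  moreover have "isolate x {{x}} = {{x}}" by (simp add: isolate_def)
  ultimately have "isolate x S = S" using isolate_Un_disjoint[of x "S - {{x}}" "{{x}}"] by metis
  then show "{x} \<in> comps S" using comps_isolate[OF B uniq] singleton_in_isolate by metis
qed

section \<open>Composition and isolated points\<close>

lemma finite_points [simp]: "finite (points k l)"
  by (simp add: points_def)

lemma points_iff [simp]: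
  "Upper j \<in> points k l \<longleftrightarrow> 1 \<le> j \<and> j \<le> k"
  "Lower j \<in> points k l \<longleftrightarrow> 1 \<le> j \<and> j \<le> l"
  by (auto simp: points_def)

lemma isolate_parts: "p \<in> parts k l \<Longrightarrow> x \<in> points k l \<Longrightarrow> isolate x p \<in> parts k l"
  by (simp add: parts_def partition_on_isolate)

lemma parts_block:
  assumes "p \<in> parts k l" "x \<in> points k l"
  obtains B where "B \<in> p" "x \<in> B" "\<And>B'. B' \<in> p \<Longrightarrow> x \<in> B' \<Longrightarrow> B' = B"
proof -
  have p: "partition_on (points k l) p" using assms(1) by (simp add: parts_def)
  then obtain B where "B \<in> p" "x \<in> B" using assms(2) partition_onD1 by blast
  moreover have "B' = B" if "B' \<in> p" "x \<in> B'" for B'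
    using disjointD[OF partition_onD2[OF p] that(1) \<open>B \<in> p\<close>] that(2) \<open>x \<in> B\<close> by blast
  ultimately show ?thesis using that by blast
qed

lemma empty_notin_parts: "p \<in> parts k l \<Longrightarrow> {} \<notin> p"
  by (auto simp: parts_def dest: partition_onD3)

lemma inj_case_point:
  "inj (case_point Top Mid)" "inj (case_point Mid Bot)" "inj (case_point Top Bot)"
  by (auto intro!: injI split: point.splits)

lemma range_case_point: "- range (case_point Top Bot) = range Mid"
proof (rule set_eqI)
  fix x show "x \<in> - range (case_point Top Bot) \<longleftrightarrow> x \<in> range Mid"
    by (cases x) (auto simp: image_iff split: point.splits intro: exI[of _ "Upper _"] exI[of _ "Lower _"])
qed

lemma components_eq_comps: "components q p = comps (stacked q p)"
  by (simp add: components_def comps_def)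

lemma empty_notin_stacked: "p \<in> parts k l \<Longrightarrow> q \<in> parts l m \<Longrightarrow> {} \<notin> stacked q p"
  by (auto simp: stacked_def dest: empty_notin_parts)

lemma Union_stacked:
  assumes "p \<in> parts k l" "q \<in> parts l m"
  shows "\<Union> (stacked q p) = Top ` {1..k} \<union> Mid ` {1..l} \<union> Bot ` {1..m}"
proof -
  have "\<Union>p = points k l" "\<Union>q = points l m"
    using assms by (auto simp: parts_def dest: partition_onD1)
  moreover have "\<Union> (stacked q p) = case_point Top Mid ` \<Union>p \<union> case_point Mid Bot ` \<Union>q"
    by (auto simp: stacked_def)
  ultimately show ?thesis by (auto simp: points_def image_Un image_image)
qed

lemma partition_on_components:
  assumes "p \<in> parts k l" "q \<in> parts l m"
  shows "partition_on (Top ` {1..k} \<union> Mid ` {1..l} \<union> Bot ` {1..m}) (components q p)"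
  using partition_on_comps[of "stacked q p"]
  by (simp only: Union_stacked[OF assms] components_eq_comps)

lemma comp_part_parts:
  assumes "p \<in> parts k l" "q \<in> parts l m"
  shows "comp_part q p \<in> parts k m"
proof -
  have "case_point Top Bot -` (Top ` {1..k} \<union> Mid ` {1..l} \<union> Bot ` {1..m}) = points k m"
    by (auto simp: points_def split: point.splits)
  then show ?thesis
    using partition_on_vimage[OF partition_on_components[OF assms], of "case_point Top Bot"]
    by (simp add: parts_def comp_part_def)
qed

text \<open>Outer points belong to one partition only. A middle point is glued from
  \<open>Lower j\<close> of \<open>p\<close> and \<open>Upper j\<close> of \<open>q\<close>, so
  isolating it means isolating both.\<close>

lemma stacked_isolate:
  "{} \<notin> q \<Longrightarrow> stacked q (isolate (Upper j) p) = isolate (Top j) (stacked q p)"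
  "{} \<notin> p \<Longrightarrow> stacked (isolate (Lower j) q) p = isolate (Bot j) (stacked q p)"
  "stacked (isolate (Upper j) q) (isolate (Lower j) p) = isolate (Mid j) (stacked q p)"
proof -
  note i = isolate_image[OF inj_case_point(1), symmetric] isolate_image[OF inj_case_point(2), symmetric]
  have "Top j \<notin> \<Union> ((`) (case_point Mid Bot) ` q)" "Bot j \<notin> \<Union> ((`) (case_point Top Mid) ` p)"
    by (auto split: point.splits)
  then show "{} \<notin> q \<Longrightarrow> stacked q (isolate (Upper j) p) = isolate (Top j) (stacked q p)"
    "{} \<notin> p \<Longrightarrow> stacked (isolate (Lower j) q) p = isolate (Bot j) (stacked q p)"
    using isolate_Un_disjoint[of "Top j" "(`) (case_point Mid Bot) ` q" "(`) (case_point Top Mid) ` p"]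
      isolate_Un_disjoint[of "Bot j" "(`) (case_point Top Mid) ` p" "(`) (case_point Mid Bot) ` q"]
    by (auto simp: stacked_def i Un_commute)
  show "stacked (isolate (Upper j) q) (isolate (Lower j) p) = isolate (Mid j) (stacked q p)"
    by (simp add: stacked_def isolate_Un i)
qed

text \<open>With \<open>h = case_point Top Bot\<close> this is the passage from components to
  \<open>comp_part\<close>: it commutes with cutting an outer point and does not notice cutting a
  middle point.\<close>

lemma vimage_isolate:
  assumes "inj h"
  shows "(-`) h ` isolate (h z) C - {{}} = isolate z ((-`) h ` C - {{}})"
    and "x \<notin> range h \<Longrightarrow> (-`) h ` isolate x C - {{}} = (-`) h ` C - {{}}"
proof -
  have drop: "F ` (Q - {{}}) - {{}} = F ` Q - {{}}" if "F {} = {}" for F :: "'c set \<Rightarrow> 'd set" and Q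
    using that by auto
  have "h -` {h z} = {z}" using assms by (auto dest: injD)
  moreover have "h -` (B - {h z}) = h -` B - {z}" for B
    using \<open>h -` {h z} = {z}\<close> by (simp add: vimage_Diff)
  ultimately show "(-`) h ` isolate (h z) C - {{}} = isolate z ((-`) h ` C - {{}})"
    using drop[of "(-`) h" "(\<lambda>B. B - {h z}) ` C"] drop[of "\<lambda>B. B - {z}" "(-`) h ` C"]
    by (simp add: isolate_def image_image insert_Diff_if)
  assume "x \<notin> range h"
  then have "h -` {x} = {}" "h -` (B - {x}) = h -` B" for B by auto
  then show "(-`) h ` isolate x C - {{}} = (-`) h ` C - {{}}"
    using drop[of "(-`) h" "(\<lambda>B. B - {x}) ` C"]
    by (simp add: isolate_def image_image insert_Diff_if)
qed

text \<open>
  Composing one strand of \<open>p\<close> with the projection \<open>P\<close> isolates its endpoint \<open>x\<close> and gives the factor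
  \<open>1 / \<delta>\<close>, which is cancelled by a loop if \<open>{x}\<close> is already a block.
\<close>

definition iso_coeff :: "complex \<Rightarrow> 'a \<Rightarrow> 'a set set \<Rightarrow> complex" where
  "iso_coeff \<delta> x p = (if {x} \<in> p then 1 else 1 / \<delta>)"

text \<open>Let \<open>X\<close> be the component of the outer point. If \<open>X\<close> is a
  singleton, nothing changes. If its other points are all middle points, cutting makes them a new
  loop; the loop cancels the \<open>1 / \<delta>\<close> of the stack, while the composition already
  has the singleton and coefficient \<open>1\<close>. Otherwise both sides carry
  \<open>1 / \<delta>\<close> and no loop appears.\<close>

lemma comp_isolate_outer:
  assumes p: "p \<in> parts k l" and q: "q \<in> parts l m" and "\<delta> \<noteq> 0"
    and S': "stacked q' p' = isolate (case_point Top Bot z) (stacked q p)"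
    and B: "B \<in> stacked q p" "case_point Top Bot z \<in> B"
    and uniq: "\<And>B'. B' \<in> stacked q p \<Longrightarrow> case_point Top Bot z \<in> B' \<Longrightarrow> B' = B"
  shows "comp_part q' p' = isolate z (comp_part q p)"
    and "iso_coeff \<delta> z (comp_part q p) * \<delta> ^ loops q p =
      iso_coeff \<delta> (case_point Top Bot z) (stacked q p) * \<delta> ^ loops q' p'"
proof -
  define h where "h = case_point Top Bot"
  let ?S = "stacked q p" let ?x = "h z"
  have h: "inj h" by (simp add: h_def inj_case_point)
  have B': "B \<in> ?S" "?x \<in> B" and uniq': "\<And>B'. B' \<in> ?S \<Longrightarrow> ?x \<in> B' \<Longrightarrow> B' = B \<or> B' = {?x}"
    using B uniq unfolding h_def by blast+
  have C': "components q' p' = isolate ?x (components q p)"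
    using comps_isolate[OF B' uniq'] S' by (simp add: components_eq_comps h_def)
  then show "comp_part q' p' = isolate z (comp_part q p)"
    using vimage_isolate(1)[OF h, of z "components q p"]
    by (simp add: comp_part_def h_def)
  note P = partition_on_components[OF p q]
  have xC: "{?x} \<in> components q p \<longleftrightarrow> {?x} \<in> ?S"
    using singleton_in_comps_iff[OF B' uniq' empty_notin_stacked[OF p q]] B' uniq
    unfolding components_eq_comps h_def by blast
  have xM: "?x \<notin> range Mid" by (cases z) (auto simp: h_def)
  have "?x \<in> \<Union> (components q p)"
    using B' partition_onD1[OF partition_on_comps[of ?S]] unfolding components_eq_comps by blast
  then obtain X where X: "?x \<in> X" "X \<in> components q p" by blast
  have hX: "{z} \<in> comp_part q p \<longleftrightarrow> X - {?x} \<subseteq> range Mid"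
  proof
    assume "{z} \<in> comp_part q p"
    then obtain Y where Y: "Y \<in> components q p" "h -` Y = {z}"
      by (auto simp: comp_part_def h_def)
    then have "?x \<in> Y" by auto
    then have "Y = X" using disjointD[OF partition_onD2[OF P] Y(1) X(2)] X(1) by blast
    show "X - {?x} \<subseteq> range Mid"
    proof
      fix y assume y: "y \<in> X - {?x}"
      then have "y \<notin> range h" using Y(2) \<open>Y = X\<close> by auto
      then show "y \<in> range Mid" unfolding h_def using range_case_point by blast
    qed
  next
    assume "X - {?x} \<subseteq> range Mid"
    then have "h -` X = {z}"
      using X(1) range_case_point h unfolding h_def by (auto dest: injD)
    then show "{z} \<in> comp_part q p" using X(2) by (auto simp: comp_part_def h_def image_iff)
  qed
  have "X = {?x} \<longleftrightarrow> {?x} \<in> ?S"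
    using disjointD[OF partition_onD2[OF P] X(2)] X xC by blast
  then have "loops q' p' = loops q p + (if {?x} \<notin> ?S \<and> {z} \<in> comp_part q p then 1 else 0)"
    using card_isolate_subsets[OF P _ X, of "range Mid"] xM hX
    by (simp add: loops_def C')
  moreover have "{z} \<in> comp_part q p" if "{?x} \<in> ?S"
    using hX that \<open>X = {?x} \<longleftrightarrow> {?x} \<in> ?S\<close> by simp
  ultimately show "iso_coeff \<delta> z (comp_part q p) * \<delta> ^ loops q p =
      iso_coeff \<delta> (case_point Top Bot z) (stacked q p) * \<delta> ^ loops q' p'"
    using \<open>\<delta> \<noteq> 0\<close> by (auto simp: iso_coeff_def h_def)
qed

lemma singleton_image_iff:
  assumes "inj f"
  shows "{f u} \<in> (`) f ` p \<longleftrightarrow> {u} \<in> p"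
proof -
  have "inj ((`) f)" using assms by (intro injI) (simp add: inj_image_eq_iff)
  then show ?thesis using inj_image_mem_iff[of "(`) f" "{u}" p] by simp
qed

lemma comp_isolate_upper:
  assumes p: "p \<in> parts k l" and q: "q \<in> parts l m" and "\<delta> \<noteq> 0" and j: "1 \<le> j" "j \<le> k"
  shows "comp_part q (isolate (Upper j) p) = isolate (Upper j) (comp_part q p)"
    and "iso_coeff \<delta> (Upper j) (comp_part q p) * \<delta> ^ loops q p =
      iso_coeff \<delta> (Upper j) p * \<delta> ^ loops q (isolate (Upper j) p)"
proof -
  obtain B where B: "B \<in> p" "Upper j \<in> B" and uniq: "\<And>B'. B' \<in> p \<Longrightarrow> Upper j \<in> B' \<Longrightarrow> B' = B"
    using parts_block[OF p] j by (metis points_iff(1))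
  let ?B = "case_point Top Mid ` B"
  have 1: "?B \<in> stacked q p" using B by (simp add: stacked_def)
  have 2: "case_point Top Bot (Upper j) \<in> ?B" using imageI[OF B(2), of "case_point Top Mid"] by simp
  have 3: "B' = ?B" if "B' \<in> stacked q p" "case_point Top Bot (Upper j) \<in> B'" for B'
    using that uniq by (auto simp: stacked_def split: point.splits)
  have 4: "stacked q (isolate (Upper j) p) = isolate (case_point Top Bot (Upper j)) (stacked q p)"
    using stacked_isolate(1)[OF empty_notin_parts[OF q]] by simp
  have "{Top j} \<notin> (`) (case_point Mid Bot) ` q" by (auto split: point.splits)
  then have "{Top j} \<in> stacked q p \<longleftrightarrow> {Upper j} \<in> p"
    using singleton_image_iff[OF inj_case_point(1), of "Upper j" p] by (simp add: stacked_def)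
  then show "comp_part q (isolate (Upper j) p) = isolate (Upper j) (comp_part q p)"
    "iso_coeff \<delta> (Upper j) (comp_part q p) * \<delta> ^ loops q p =
      iso_coeff \<delta> (Upper j) p * \<delta> ^ loops q (isolate (Upper j) p)"
    using comp_isolate_outer[OF p q \<open>\<delta> \<noteq> 0\<close> 4 1 2 3] by (simp_all add: iso_coeff_def)
qed

lemma comp_isolate_lower:
  assumes p: "p \<in> parts k l" and q: "q \<in> parts l m" and "\<delta> \<noteq> 0" and j: "1 \<le> j" "j \<le> m"
  shows "comp_part (isolate (Lower j) q) p = isolate (Lower j) (comp_part q p)"
    and "iso_coeff \<delta> (Lower j) (comp_part q p) * \<delta> ^ loops q p =
      iso_coeff \<delta> (Lower j) q * \<delta> ^ loops (isolate (Lower j) q) p"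
proof -
  obtain B where B: "B \<in> q" "Lower j \<in> B" and uniq: "\<And>B'. B' \<in> q \<Longrightarrow> Lower j \<in> B' \<Longrightarrow> B' = B"
    using parts_block[OF q] j by (metis points_iff(2))
  let ?B = "case_point Mid Bot ` B"
  have 1: "?B \<in> stacked q p" using B by (simp add: stacked_def)
  have 2: "case_point Top Bot (Lower j) \<in> ?B" using imageI[OF B(2), of "case_point Mid Bot"] by simp
  have 3: "B' = ?B" if "B' \<in> stacked q p" "case_point Top Bot (Lower j) \<in> B'" for B'
    using that uniq by (auto simp: stacked_def split: point.splits)
  have 4: "stacked (isolate (Lower j) q) p = isolate (case_point Top Bot (Lower j)) (stacked q p)"
    using stacked_isolate(2)[OF empty_notin_parts[OF p]] by simp
  have "{Bot j} \<notin> (`) (case_point Top Mid) ` p" by (auto split: point.splits)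
  then have "{Bot j} \<in> stacked q p \<longleftrightarrow> {Lower j} \<in> q"
    using singleton_image_iff[OF inj_case_point(2), of "Lower j" q] by (simp add: stacked_def)
  then show "comp_part (isolate (Lower j) q) p = isolate (Lower j) (comp_part q p)"
    "iso_coeff \<delta> (Lower j) (comp_part q p) * \<delta> ^ loops q p =
      iso_coeff \<delta> (Lower j) q * \<delta> ^ loops (isolate (Lower j) q) p"
    using comp_isolate_outer[OF p q \<open>\<delta> \<noteq> 0\<close> 4 1 2 3] by (simp_all add: iso_coeff_def)
qed

text \<open>Cutting a middle point leaves the outer rows untouched. Unless the point was a component
  by itself, the loop count rises by one, since \<open>{Mid j}\<close> is a loop; the factor
  \<open>1 / \<delta>\<close> pays for it.\<close>

lemma comp_isolate_mid:
  fixes \<delta> :: complex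
  assumes p: "p \<in> parts k l" and q: "q \<in> parts l m" and "\<delta> \<noteq> 0"
    and S': "stacked q' p' = isolate (Mid j) (stacked q p)"
    and B: "B \<in> stacked q p" "Mid j \<in> B"
    and uniq: "\<And>B'. B' \<in> stacked q p \<Longrightarrow> Mid j \<in> B' \<Longrightarrow> B' = B \<or> B' = {Mid j}"
  shows "comp_part q' p' = comp_part q p"
    and "\<delta> ^ loops q p = (if B = {Mid j} then 1 else 1 / \<delta>) * \<delta> ^ loops q' p'"
proof -
  have C': "components q' p' = isolate (Mid j) (components q p)"
    using comps_isolate[OF B uniq] S' by (simp add: components_eq_comps)
  have "Mid j \<notin> range (case_point Top Bot)" by (auto split: point.splits)
  from vimage_isolate(2)[OF inj_case_point(3) this] show "comp_part q' p' = comp_part q p"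
    by (simp add: comp_part_def C')
  note P = partition_on_components[OF p q]
  have "Mid j \<in> \<Union> (components q p)"
    using B partition_onD1[OF partition_on_comps[of "stacked q p"]]
    unfolding components_eq_comps by blast
  then obtain X where X: "Mid j \<in> X" "X \<in> components q p" by blast
  have "X = {Mid j} \<longleftrightarrow> {Mid j} \<in> components q p"
    using disjointD[OF partition_onD2[OF P] X(2)] X by blast
  also have "\<dots> \<longleftrightarrow> B = {Mid j}"
    using singleton_in_comps_iff[OF B uniq empty_notin_stacked[OF p q]]
    by (simp add: components_eq_comps)
  finally have "loops q' p' = loops q p + (if B = {Mid j} then 0 else 1)"
    using card_isolate_subsets[OF P _ X, of "range Mid"] by (simp add: loops_def C')
  then show "\<delta> ^ loops q p = (if B = {Mid j} then 1 else 1 / \<delta>) * \<delta> ^ loops q' p'"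
    using \<open>\<delta> \<noteq> 0\<close> by simp
qed

text \<open>Both sides are compared with the diagram in which the middle point is cut in
  \<open>p\<close> and in \<open>q\<close>. Since isolation is idempotent, that diagram arises from
  each one-sided diagram by isolating \<open>Mid j\<close>, and \<open>comp_isolate_mid\<close>
  applies twice.\<close>

lemma comp_isolate_slide:
  assumes p: "p \<in> parts k l" and q: "q \<in> parts l m" and "\<delta> \<noteq> 0" and j: "1 \<le> j" "j \<le> l"
  shows "comp_part q (isolate (Lower j) p) = comp_part (isolate (Upper j) q) p"
    and "iso_coeff \<delta> (Lower j) p * \<delta> ^ loops q (isolate (Lower j) p) =
      iso_coeff \<delta> (Upper j) q * \<delta> ^ loops (isolate (Upper j) q) p"
proof -
  let ?p = "isolate (Lower j) p" and ?q = "isolate (Upper j) q"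
  let ?f = "case_point Top Mid" and ?g = "case_point Mid Bot"
  have p': "?p \<in> parts k l" and q': "?q \<in> parts l m"
    using isolate_parts[OF p] isolate_parts[OF q] j by simp_all
  have pp: "isolate (Lower j) ?p = ?p" and qq: "isolate (Upper j) ?q = ?q"
    using p' q' by (auto simp: parts_def intro!: isolate_trivial)
  obtain B where B: "B \<in> p" "Lower j \<in> B" and uB: "\<And>B'. B' \<in> p \<Longrightarrow> Lower j \<in> B' \<Longrightarrow> B' = B"
    using parts_block[OF p] j by (metis points_iff(2))
  obtain C where C: "C \<in> q" "Upper j \<in> C" and uC: "\<And>B'. B' \<in> q \<Longrightarrow> Upper j \<in> B' \<Longrightarrow> B' = C"
    using parts_block[OF q] j by (metis points_iff(1))
  have s1: "stacked ?q ?p = isolate (Mid j) (stacked q ?p)"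
    using stacked_isolate(3)[of j q ?p] by (simp add: pp)
  have s2: "stacked ?q ?p = isolate (Mid j) (stacked ?q p)"
    using stacked_isolate(3)[of j ?q p] by (simp add: qq)
  have 1: "?g ` C \<in> stacked q ?p" "Mid j \<in> ?g ` C"
    using C imageI[OF C(2), of ?g] by (simp_all add: stacked_def)
  have u1: "B' = ?g ` C \<or> B' = {Mid j}" if "B' \<in> stacked q ?p" "Mid j \<in> B'" for B'
    using that uC by (auto simp: stacked_def in_isolate_iff split: point.splits)
  have 2: "?f ` B \<in> stacked ?q p" "Mid j \<in> ?f ` B"
    using B imageI[OF B(2), of ?f] by (simp_all add: stacked_def)
  have u2: "B' = ?f ` B \<or> B' = {Mid j}" if "B' \<in> stacked ?q p" "Mid j \<in> B'" for B'
    using that uB by (auto simp: stacked_def in_isolate_iff split: point.splits)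
  note r1 = comp_isolate_mid[OF p' q \<open>\<delta> \<noteq> 0\<close> s1 1 u1]
  note r2 = comp_isolate_mid[OF p q' \<open>\<delta> \<noteq> 0\<close> s2 2 u2]
  show "comp_part q ?p = comp_part ?q p" using r1(1) r2(1) by simp
  have "?g ` C = {Mid j} \<longleftrightarrow> C = {Upper j}"
    using inj_image_eq_iff[OF inj_case_point(2), of C "{Upper j}"] by simp
  also have "\<dots> \<longleftrightarrow> {Upper j} \<in> q" using C uC by blast
  finally have c1: "(if ?g ` C = {Mid j} then 1 else 1 / \<delta>) = iso_coeff \<delta> (Upper j) q"
    by (simp add: iso_coeff_def)
  have "?f ` B = {Mid j} \<longleftrightarrow> B = {Lower j}"
    using inj_image_eq_iff[OF inj_case_point(1), of B "{Lower j}"] by simp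
  also have "\<dots> \<longleftrightarrow> {Lower j} \<in> p" using B uB by blast
  finally have c2: "(if ?f ` B = {Mid j} then 1 else 1 / \<delta>) = iso_coeff \<delta> (Lower j) p"
    by (simp add: iso_coeff_def)
  show "iso_coeff \<delta> (Lower j) p * \<delta> ^ loops q ?p = iso_coeff \<delta> (Upper j) q * \<delta> ^ loops ?q p"
    using r1(2) r2(2) unfolding c1 c2 by (simp add: mult_ac)
qed

section \<open>Linear combinations\<close>

interpretation lp: vector_space pscale by (rule vector_space_pscale)

lemma single_eq_pscale: "Poly_Mapping.single p c = pscale c (basis p)"
  by (rule poly_mapping_eqI) (simp add: lookup_single when_def)

text \<open>Tensor product and composition are both rewritten as iterated instances of this linear
  extension and inherit their linearity from it.\<close>

definition lin :: "(spart \<Rightarrow> lpart) \<Rightarrow> lpart \<Rightarrow> lpart" where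
  "lin f x = (\<Sum>p\<in>Poly_Mapping.keys x. pscale (Poly_Mapping.lookup x p) (f p))"

lemma lin_basis [simp]: "lin f (basis p) = f p"
  by (simp add: lin_def)

lemma sum_keys_pscale:
  assumes "\<And>p. g p 0 = 0" and "\<And>p a. g p (c * a) = pscale d (g p a)"
  shows "(\<Sum>p\<in>Poly_Mapping.keys (pscale c x). g p (Poly_Mapping.lookup (pscale c x) p)) =
    pscale d (\<Sum>p\<in>Poly_Mapping.keys x. g p (Poly_Mapping.lookup x p))"
proof -
  \<comment> \<open>For \<open>c = 0\<close> the set of keys shrinks; \<open>g p 0 = 0\<close>
    permits summing over the keys of \<open>x\<close> on both sides.\<close>
  have "(\<Sum>p\<in>Poly_Mapping.keys (pscale c x). g p (Poly_Mapping.lookup (pscale c x) p)) =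
      (\<Sum>p\<in>Poly_Mapping.keys x. g p (Poly_Mapping.lookup (pscale c x) p))"
    by (rule sum.mono_neutral_left)
      (auto simp: in_keys_iff assms(1) simp del: lookup_not_eq_zero_eq_in_keys)
  then show ?thesis by (simp add: assms(2) lp.scale_sum_right)
qed

text \<open>The parameter treats linear maps (\<open>id\<close>) and the antilinear involution
  (\<open>cnj\<close>) alike.\<close>

definition semilinear :: "(complex \<Rightarrow> complex) \<Rightarrow> (lpart \<Rightarrow> lpart) \<Rightarrow> bool" where
  "semilinear \<sigma> F \<longleftrightarrow>
    (\<forall>x y. F (x + y) = F x + F y) \<and> (\<forall>c x. F (pscale c x) = pscale (\<sigma> c) (F x))"

lemma semilinear_add: "semilinear \<sigma> F \<Longrightarrow> F (x + y) = F x + F y"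
  by (simp add: semilinear_def)

lemma semilinear_scale: "semilinear \<sigma> F \<Longrightarrow> F (pscale c x) = pscale (\<sigma> c) (F x)"
  by (simp add: semilinear_def)

lemma semilinear_0: "semilinear \<sigma> F \<Longrightarrow> F 0 = 0"
  using semilinear_add[of \<sigma> F 0 0] by simp

lemma linear_compose_left: "semilinear id F \<Longrightarrow> semilinear \<tau> G \<Longrightarrow> semilinear \<tau> (\<lambda>x. F (G x))"
  by (simp add: semilinear_def)

lemma semilinear_lin: "semilinear id (lin f)"
  unfolding semilinear_def
proof (intro conjI allI)
  show "lin f (x + y) = lin f x + lin f y" for x y
    unfolding lin_def by (rule setsum_keys_plus_distrib) (simp_all add: lp.scale_left_distrib)
  show "lin f (pscale c x) = pscale (id c) (lin f x)" for c x
    unfolding lin_def by (rule sum_keys_pscale[where g = "\<lambda>p a. pscale a (f p)"]) simp_all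
qed

lemma semilinear_lin_fun:
  assumes "\<And>p. semilinear id (\<lambda>y. f y p)"
  shows "semilinear id (\<lambda>y. lin (f y) x)"
  using assms
  by (simp add: semilinear_def lin_def lp.scale_right_distrib sum.distrib lp.scale_sum_right
      mult.commute)

lemma tensor_eq_lin: "tensor k l x y = lin (\<lambda>p. lin (\<lambda>q. basis (tensor_part k l p q)) y) x"
  unfolding tensor_def lin_def lp.scale_sum_right
  by (intro sum.cong refl) (simp add: single_eq_pscale[where c = "_ * _"])

lemma compose_eq_lin:
  "compose_lin \<delta> y x = lin (\<lambda>q. lin (\<lambda>p. pscale (\<delta> ^ loops q p) (basis (comp_part q p))) x) y"
  unfolding compose_lin_def lin_def lp.scale_sum_right
  by (intro sum.cong refl) (simp add: single_eq_pscale[where c = "_ * _"] mult.assoc)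

lemma linear_tensor: "semilinear id (\<lambda>x. tensor k l x y)" "semilinear id (tensor k l x)"
  unfolding tensor_eq_lin by (intro semilinear_lin semilinear_lin_fun)+

lemma linear_compose: "semilinear id (\<lambda>y. compose_lin \<delta> y x)" "semilinear id (compose_lin \<delta> y)"
  unfolding compose_eq_lin by (intro semilinear_lin semilinear_lin_fun)+

lemmas tensor_simps [simp] =
  linear_tensor[THEN semilinear_add] linear_tensor[THEN semilinear_scale, unfolded id_apply]

lemmas compose_simps [simp] =
  linear_compose[THEN semilinear_add] linear_compose[THEN semilinear_scale, unfolded id_apply]

lemma tensor_basis [simp]: "tensor k l (basis p) (basis q) = basis (tensor_part k l p q)"
  by (simp add: tensor_eq_lin)

lemma compose_basis [simp]:
  "compose_lin \<delta> (basis q) (basis p) = pscale (\<delta> ^ loops q p) (basis (comp_part q p))"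
  by (simp add: compose_eq_lin)

lemma semilinear_star:
  assumes "\<sigma> = cnj \<or> \<sigma> = id"
  shows "semilinear \<sigma> (star \<sigma>)"
  unfolding semilinear_def
proof (intro conjI allI)
  have \<sigma>: "\<sigma> 0 = 0" "\<sigma> (a + b) = \<sigma> a + \<sigma> b" "\<sigma> (a * b) = \<sigma> a * \<sigma> b" for a b
    using assms by auto
  show "star \<sigma> (x + y) = star \<sigma> x + star \<sigma> y" for x y
    unfolding star_def by (rule setsum_keys_plus_distrib) (simp_all add: \<sigma> single_add)
  have "Poly_Mapping.single (star_part p) (\<sigma> (c * a)) =
      pscale (\<sigma> c) (Poly_Mapping.single (star_part p) (\<sigma> a))" for p a c
    by (rule poly_mapping_eqI) (simp add: lookup_single when_def \<sigma>)
  then show "star \<sigma> (pscale c x) = pscale (\<sigma> c) (star \<sigma> x)" for c x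
    unfolding star_def
    by (intro sum_keys_pscale[where g = "\<lambda>p a. Poly_Mapping.single (star_part p) (\<sigma> a)"])
      (simp_all add: \<sigma>)
qed

lemma star_basis [simp]: "\<sigma> 1 = 1 \<Longrightarrow> star \<sigma> (basis p) = basis (star_part p)"
  by (simp add: star_def)

section \<open>Morphism spaces and reduction to basis partitions\<close>

lemma Part_0 [simp]: "0 \<in> Part k l"
  by (simp add: Part_def)

lemma Part_add: "x \<in> Part k l \<Longrightarrow> y \<in> Part k l \<Longrightarrow> x + y \<in> Part k l"
  using keys_add[of x y] by (auto simp: Part_def)

lemma Part_scale: "x \<in> Part k l \<Longrightarrow> pscale c x \<in> Part k l"
  by (simp add: Part_def subset_iff in_keys_iff)

lemma basis_Part [simp]: "basis p \<in> Part k l \<longleftrightarrow> p \<in> parts k l"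
  by (simp add: Part_def)

lemma Part_induct [consumes 1, case_names zero add]:
  assumes x: "x \<in> Part k l" and zero: "P 0"
    and add: "\<And>c p y. p \<in> parts k l \<Longrightarrow> y \<in> Part k l \<Longrightarrow> P y \<Longrightarrow> P (pscale c (basis p) + y)"
  shows "P x"
proof -
  let ?s = "\<lambda>F. \<Sum>p\<in>F. pscale (Poly_Mapping.lookup x p) (basis p)"
  have *: "?s F \<in> Part k l \<and> P (?s F)" if "finite F" "F \<subseteq> Poly_Mapping.keys x" for F
    using that
  proof (induction F rule: finite_induct)
    case (insert p F)
    then have "p \<in> parts k l" using x by (auto simp: Part_def)
    then show ?case using insert add by (simp add: Part_add Part_scale)
  qed (simp add: zero)
  have "?s (Poly_Mapping.keys x) = x"
  proof (rule poly_mapping_eqI)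
    fix r
    have "Poly_Mapping.lookup (?s (Poly_Mapping.keys x)) r =
        (\<Sum>p\<in>Poly_Mapping.keys x. if p = r then Poly_Mapping.lookup x p else 0)"
      unfolding lookup_sum by (rule sum.cong) (simp_all add: lookup_single when_def)
    also have "\<dots> = Poly_Mapping.lookup x r"
      by (simp add: not_in_keys_iff_lookup_eq_zero)
    finally show "Poly_Mapping.lookup (?s (Poly_Mapping.keys x)) r = Poly_Mapping.lookup x r" .
  qed
  then show ?thesis using *[OF finite_keys order_refl] by simp
qed

text \<open>The identities for \<open>proj\<close> are reduced to single partitions by this lemma
  and its bilinear form \<open>bilinear_eqI\<close>; the antilinear star is included through
  \<open>\<sigma>\<close>.\<close>

lemma semilinear_eqI:
  assumes "x \<in> Part k l" "semilinear \<sigma> F" "semilinear \<sigma> G"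
    and "\<And>p. p \<in> parts k l \<Longrightarrow> F (basis p) = G (basis p)"
  shows "F x = G x"
  using assms(1)
proof (induction rule: Part_induct)
  case zero
  then show ?case using assms(2,3) by (simp add: semilinear_0)
next
  case (add c p y)
  then show ?case
    using assms(4) by (simp add: semilinear_add[OF assms(2)] semilinear_add[OF assms(3)]
      semilinear_scale[OF assms(2)] semilinear_scale[OF assms(3)])
qed

lemma semilinear_Part:
  assumes "x \<in> Part k l" "semilinear \<sigma> F" "\<And>p. p \<in> parts k l \<Longrightarrow> F (basis p) \<in> Part k' l'"
  shows "F x \<in> Part k' l'"
  using assms(1)
proof (induction rule: Part_induct)
  case zero
  then show ?case using assms(2) by (simp add: semilinear_0)
next
  case (add c p y)
  then show ?case
    using assms(3) by (simp add: semilinear_add[OF assms(2)] semilinear_scale[OF assms(2)]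
      Part_add Part_scale)
qed

lemma inj_shift_point: "inj (shift_point k l)"
proof (rule injI)
  fix a b assume "shift_point k l a = shift_point k l b"
  then show "a = b" by (cases a; cases b) auto
qed

lemma inj_flip_point: "inj flip_point"
proof (rule injI)
  fix a b assume "flip_point a = flip_point b"
  then show "a = b" by (cases a; cases b) auto
qed

lemma partition_on_image_parts:
  assumes "inj f" "p \<in> parts k l"
  shows "partition_on (f ` points k l) ((`) f ` p)"
proof -
  have "{} \<notin> (`) f ` p" using empty_notin_parts[OF assms(2)] by auto
  then show ?thesis
    using partition_on_inj_image[OF _ inj_on_subset[OF assms(1) subset_UNIV], of "points k l" p]
      assms(2) by (simp add: parts_def)
qed

lemma shift_points:
  "shift_point k l ` points k' l' = Upper ` {k<..k + k'} \<union> Lower ` {l<..l + l'}"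
proof -
  have "(\<lambda>j. k + j) ` {1..k'} = {k<..k + k'}" for k k' :: nat
    unfolding image_add_atLeastAtMost by auto
  then have "(\<lambda>j. U (k + j)) ` {1..k'} = U ` {k<..k + k'}" for U :: "nat \<Rightarrow> point" and k k'
    by (metis image_image)
  then show ?thesis by (simp add: points_def image_Un image_image del: One_nat_def)
qed

lemma tensor_part_parts:
  assumes "p \<in> parts k l" "q \<in> parts k' l'"
  shows "tensor_part k l p q \<in> parts (k + k') (l + l')"
proof -
  let ?q = "(`) (shift_point k l) ` q"
  have p: "partition_on (points k l) p" using assms(1) by (simp add: parts_def)
  have q: "partition_on (shift_point k l ` points k' l') ?q"
    by (rule partition_on_image_parts[OF inj_shift_point assms(2)])
  have disj: "points k l \<inter> shift_point k l ` points k' l' = {}"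
    unfolding shift_points by (auto simp: points_def)
  have U: "points (k + k') (l + l') = points k l \<union> shift_point k l ` points k' l'"
  proof -
    have "{1..k + k'} = {1..k} \<union> {k<..k + k'}" for k k' :: nat by auto
    then show ?thesis unfolding shift_points by (simp only: points_def image_Un Un_ac)
  qed
  have "disjoint (p \<union> ?q)"
    using disjoint_union[OF partition_onD2[OF p] partition_onD2[OF q]] disj
    by (simp only: partition_onD1[OF p, symmetric] partition_onD1[OF q, symmetric])
  moreover have "\<Union> (p \<union> ?q) = points (k + k') (l + l')"
    by (simp only: U Union_Un_distrib partition_onD1[OF p, symmetric] partition_onD1[OF q, symmetric])
  moreover have "{} \<notin> p \<union> ?q" using partition_onD3[OF p] partition_onD3[OF q] by blast
  ultimately show ?thesis
    by (simp only: parts_def tensor_part_def mem_Collect_eq partition_on_def simp_thms)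
qed

lemma star_part_parts:
  assumes "p \<in> parts k l"
  shows "star_part p \<in> parts l k"
proof -
  have "flip_point ` points k l = points l k"
    by (auto simp: points_def image_Un image_image)
  then show ?thesis
    using partition_on_image_parts[OF inj_flip_point assms] by (simp add: parts_def star_part_def)
qed

lemma bilinear_eqI:
  assumes "x \<in> Part k l" "y \<in> Part k' l'"
    and "\<And>y. semilinear id (\<lambda>x. F x y)" "\<And>x. semilinear id (F x)"
    and "\<And>y. semilinear id (\<lambda>x. G x y)" "\<And>x. semilinear id (G x)"
    and "\<And>p q. p \<in> parts k l \<Longrightarrow> q \<in> parts k' l' \<Longrightarrow> F (basis p) (basis q) = G (basis p) (basis q)"
  shows "F x y = G x y"
  by (rule semilinear_eqI[OF assms(1,3,5)], rule semilinear_eqI[OF assms(2,4,6)], rule assms(7))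

lemma tensor_Part:
  assumes "x \<in> Part k l" "y \<in> Part k' l'"
  shows "tensor k l x y \<in> Part (k + k') (l + l')"
  by (intro semilinear_Part[OF assms(1) linear_tensor(1)] semilinear_Part[OF assms(2) linear_tensor(2)])
    (simp add: tensor_part_parts)

lemma compose_Part:
  assumes "x \<in> Part k l" "y \<in> Part l m"
  shows "compose_lin \<delta> y x \<in> Part k m"
  by (intro semilinear_Part[OF assms(1) linear_compose(2)] semilinear_Part[OF assms(2) linear_compose(1)])
    (simp add: comp_part_parts Part_scale)

lemma star_Part:
  assumes "x \<in> Part k l" "\<sigma> = cnj \<or> \<sigma> = id"
  shows "star \<sigma> x \<in> Part l k"
proof (intro semilinear_Part[OF assms(1) semilinear_star[OF assms(2)]])
  fix p assume "p \<in> parts k l"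
  then show "star \<sigma> (basis p) \<in> Part l k" using assms(2) by (auto simp: star_part_parts)
qed

section \<open>Operators on the strands\<close>

text \<open>The two factors occupy disjoint sets of points, so cutting a point of one leaves the
  blocks of the other alone.\<close>

lemma tensor_part_isolate:
  assumes "p \<in> parts k l" "q \<in> parts k' l'"
  shows "x \<in> points k l \<Longrightarrow> tensor_part k l (isolate x p) q = isolate x (tensor_part k l p q)"
    and "x \<in> points k' l' \<Longrightarrow>
      tensor_part k l p (isolate x q) = isolate (shift_point k l x) (tensor_part k l p q)"
    and "x \<in> points k l \<Longrightarrow> iso_coeff \<delta> x (tensor_part k l p q) = iso_coeff \<delta> x p"
    and "x \<in> points k' l' \<Longrightarrow>
      iso_coeff \<delta> (shift_point k l x) (tensor_part k l p q) = iso_coeff \<delta> x q"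
proof -
  let ?f = "shift_point k l"
  let ?q = "(`) ?f ` q"
  have U: "\<Union>p = points k l" "\<Union>?q = ?f ` points k' l'"
    using assms(1) partition_onD1[OF partition_on_image_parts[OF inj_shift_point assms(2)]]
    by (auto simp: parts_def dest: partition_onD1)
  have E: "{} \<notin> p" "{} \<notin> ?q"
    using empty_notin_parts[OF assms(1)] empty_notin_parts[OF assms(2)] by auto
  have disj: "points k l \<inter> ?f ` points k' l' = {}"
    unfolding shift_points by (auto simp: points_def)
  show "tensor_part k l (isolate x p) q = isolate x (tensor_part k l p q)" if "x \<in> points k l"
  proof -
    have "x \<notin> \<Union>?q" using U(2) disj that by blast
    then show ?thesis using isolate_Un_disjoint[OF _ E(2)] by (simp add: tensor_part_def)
  qed
  show "tensor_part k l p (isolate x q) = isolate (?f x) (tensor_part k l p q)"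
    if "x \<in> points k' l'"
  proof -
    have "?f x \<notin> \<Union>p" using U(1) disj that by blast
    then show ?thesis
      using isolate_Un_disjoint[OF _ E(1), of "?f x" ?q]
      by (simp add: tensor_part_def isolate_image[OF inj_shift_point] Un_commute)
  qed
  show "iso_coeff \<delta> x (tensor_part k l p q) = iso_coeff \<delta> x p" if "x \<in> points k l"
  proof -
    have "{x} \<notin> ?q" using U(2) disj that by blast
    then show ?thesis by (simp add: iso_coeff_def tensor_part_def)
  qed
  show "iso_coeff \<delta> (?f x) (tensor_part k l p q) = iso_coeff \<delta> x q" if "x \<in> points k' l'"
  proof -
    have "{?f x} \<notin> p" using U(1) disj that by blast
    then show ?thesis
      using singleton_image_iff[OF inj_shift_point, of k l x q]
      by (simp add: iso_coeff_def tensor_part_def)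
  qed
qed

text \<open>If \<open>{x, y}\<close> is a block, cutting either point turns the other into a
  singleton, and both orders pay \<open>1 / \<delta>\<close> once. In all other cases with distinct
  points, cutting one does not change whether the other is a singleton. This is the scalar part of
  the commutation of projections.\<close>

lemma iso_coeff_isolate:
  assumes "p \<in> parts k l" "x \<in> points k l" "y \<in> points k l"
  shows "iso_coeff \<delta> x p * iso_coeff \<delta> y (isolate x p) = iso_coeff \<delta> y p * iso_coeff \<delta> x (isolate y p)"
proof (cases "x = y")
  case False
  have p: "partition_on (points k l) p" using assms(1) by (simp add: parts_def)
  have "{x} \<notin> p \<and> {y} \<notin> p" if "{x, y} \<in> p"
    using disjointD[OF partition_onD2[OF p] that, of "{x}"]
      disjointD[OF partition_onD2[OF p] that, of "{y}"] False by auto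
  then show ?thesis
    using singleton_in_isolate_iff[OF p assms(2) False]
      singleton_in_isolate_iff[OF p assms(3), of x] False
    by (auto simp: iso_coeff_def insert_commute)
qed simp

section \<open>The projection \<open>P\<close> on a single strand\<close>

locale nonzero_loop =
  fixes \<delta> :: complex
  assumes \<delta>: "\<delta> \<noteq> 0"
begin

text \<open>Attaching \<open>P\<close> at the endpoint \<open>x\<close>, written directly on
  partitions so that upper and lower points are treated alike.\<close>

definition proj :: "point \<Rightarrow> lpart \<Rightarrow> lpart" where
  "proj x = lin (\<lambda>p. pscale (iso_coeff \<delta> x p) (basis (isolate x p)))"

lemma linear_proj: "semilinear id (proj x)"
  unfolding proj_def by (rule semilinear_lin)

lemma proj_basis: "proj x (basis p) = pscale (iso_coeff \<delta> x p) (basis (isolate x p))"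
  by (simp add: proj_def)

lemmas proj_simps [simp] =
  linear_proj[THEN semilinear_add] linear_proj[THEN semilinear_scale, unfolded id_apply]

lemma proj_Part: "y \<in> Part k l \<Longrightarrow> x \<in> points k l \<Longrightarrow> proj x y \<in> Part k l"
  by (erule semilinear_Part[OF _ linear_proj]) (simp add: proj_basis isolate_parts Part_scale)

text \<open>After the first isolation \<open>{x}\<close> is a block, so the second carries
  coefficient \<open>1\<close>.\<close>

lemma proj_idem:
  assumes "y \<in> Part k l" "x \<in> points k l"
  shows "proj x (proj x y) = proj x y"
proof (rule semilinear_eqI[OF assms(1) linear_compose_left[OF linear_proj linear_proj] linear_proj])
  fix p assume "p \<in> parts k l"
  then have "isolate x (isolate x p) = isolate x p"
    using isolate_parts[OF _ assms(2), of p] by (auto simp: parts_def intro!: isolate_trivial)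
  then show "proj x (proj x (basis p)) = proj x (basis p)"
    by (simp add: proj_basis iso_coeff_def)
qed

lemma proj_commute:
  assumes "y \<in> Part k l" "x \<in> points k l" "x' \<in> points k l"
  shows "proj x (proj x' y) = proj x' (proj x y)"
proof (rule semilinear_eqI[OF assms(1) linear_compose_left[OF linear_proj linear_proj]
      linear_compose_left[OF linear_proj linear_proj]])
  fix p assume "p \<in> parts k l"
  then show "proj x (proj x' (basis p)) = proj x' (proj x (basis p))"
    using iso_coeff_isolate[OF _ assms(3,2), of p \<delta>]
    by (simp add: proj_basis isolate_commute[of x x'] mult.commute)
qed

lemma proj_tensor_left:
  assumes "x \<in> Part k l" "y \<in> Part k' l'" "z \<in> points k l"
  shows "tensor k l (proj z x) y = proj z (tensor k l x y)"
  by (rule bilinear_eqI[OF assms(1,2), where F = "\<lambda>x y. tensor k l (proj z x) y"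
        and G = "\<lambda>x y. proj z (tensor k l x y)"])
    (simp_all add: semilinear_def proj_basis tensor_part_isolate assms(3))

lemma proj_tensor_right:
  assumes "x \<in> Part k l" "y \<in> Part k' l'" "z \<in> points k' l'"
  shows "tensor k l x (proj z y) = proj (shift_point k l z) (tensor k l x y)"
  by (rule bilinear_eqI[OF assms(1,2), where F = "\<lambda>x y. tensor k l x (proj z y)"
        and G = "\<lambda>x y. proj (shift_point k l z) (tensor k l x y)"])
    (simp_all add: semilinear_def proj_basis tensor_part_isolate assms(3))

lemma proj_compose_upper:
  assumes "x \<in> Part k l" "y \<in> Part l m" "1 \<le> j" "j \<le> k"
  shows "compose_lin \<delta> y (proj (Upper j) x) = proj (Upper j) (compose_lin \<delta> y x)"
  by (rule bilinear_eqI[OF assms(1,2), where F = "\<lambda>x y. compose_lin \<delta> y (proj (Upper j) x)"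
        and G = "\<lambda>x y. proj (Upper j) (compose_lin \<delta> y x)"])
    (simp_all add: semilinear_def proj_basis mult.commute comp_isolate_upper(1)[OF _ _ \<delta> assms(3,4)]
      comp_isolate_upper(2)[OF _ _ \<delta> assms(3,4), symmetric])

lemma proj_compose_lower:
  assumes "x \<in> Part k l" "y \<in> Part l m" "1 \<le> j" "j \<le> m"
  shows "compose_lin \<delta> (proj (Lower j) y) x = proj (Lower j) (compose_lin \<delta> y x)"
  by (rule bilinear_eqI[OF assms(1,2), where F = "\<lambda>x y. compose_lin \<delta> (proj (Lower j) y) x"
        and G = "\<lambda>x y. proj (Lower j) (compose_lin \<delta> y x)"])
    (simp_all add: semilinear_def proj_basis mult.commute comp_isolate_lower(1)[OF _ _ \<delta> assms(3,4)]
      comp_isolate_lower(2)[OF _ _ \<delta> assms(3,4), symmetric])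

lemma proj_compose_slide:
  assumes "x \<in> Part k l" "y \<in> Part l m" "1 \<le> j" "j \<le> l"
  shows "compose_lin \<delta> (proj (Upper j) y) x = compose_lin \<delta> y (proj (Lower j) x)"
  by (rule bilinear_eqI[OF assms(1,2), where F = "\<lambda>x y. compose_lin \<delta> (proj (Upper j) y) x"
        and G = "\<lambda>x y. compose_lin \<delta> y (proj (Lower j) x)"])
    (simp_all add: semilinear_def proj_basis comp_isolate_slide[OF _ _ \<delta> assms(3,4)])

lemma proj_star:
  assumes "\<sigma> = cnj \<or> \<sigma> = id" "\<sigma> \<delta> = \<delta>" "x \<in> Part k l"
  shows "star \<sigma> (proj z x) = proj (flip_point z) (star \<sigma> x)"
proof (rule semilinear_eqI[OF assms(3)])
  note S = semilinear_star[OF assms(1)]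
  show "semilinear \<sigma> (\<lambda>x. star \<sigma> (proj z x))" "semilinear \<sigma> (\<lambda>x. proj (flip_point z) (star \<sigma> x))"
    by (simp_all add: semilinear_def semilinear_add[OF S] semilinear_scale[OF S])
  fix p
  have "\<sigma> 1 = 1" using assms(1) by auto
  \<comment> \<open>The coefficient \<open>1 / \<delta>\<close> must be fixed by
    \<open>\<sigma>\<close>; this is where \<open>\<sigma> \<delta> = \<delta>\<close>
    enters.\<close>
  moreover have "\<sigma> (iso_coeff \<delta> z p) = iso_coeff \<delta> (flip_point z) (star_part p)"
    using singleton_image_iff[OF inj_flip_point, of z p] assms(1,2)
    by (auto simp: iso_coeff_def star_part_def)
  moreover have "star_part (isolate z p) = isolate (flip_point z) (star_part p)"
    by (simp add: star_part_def isolate_image[OF inj_flip_point])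
  ultimately show "star \<sigma> (proj z (basis p)) = proj (flip_point z) (star \<sigma> (basis p))"
    by (simp add: proj_basis semilinear_scale[OF S])
qed

section \<open>Operators \<open>1 + (a - 1) P\<close> on a strand\<close>

definition strand :: "complex \<Rightarrow> point \<Rightarrow> lpart \<Rightarrow> lpart" where
  "strand a x y = y + pscale (a - 1) (proj x y)"

lemma linear_strand: "semilinear id (strand a x)"
  by (simp add: semilinear_def strand_def lp.scale_right_distrib mult.commute)

lemma strand_1 [simp]: "strand 1 x y = y"
  by (simp add: strand_def)

lemma strand_Part: "y \<in> Part k l \<Longrightarrow> x \<in> points k l \<Longrightarrow> strand a x y \<in> Part k l"
  by (simp add: strand_def Part_add Part_scale proj_Part)

text \<open>Such an operator has eigenvalue \<open>a\<close> on the image of \<open>P\<close> and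
  \<open>1\<close> on its kernel, so these operators multiply like their parameters:
  \<open>\<tau>\<close> is \<open>a = - 1\<close>, \<open>\<rho>\<close> is \<open>a = \<i>\<close>
  and its inverse \<open>a = - \<i>\<close>.\<close>

lemma strand_strand:
  assumes "y \<in> Part k l" "x \<in> points k l"
  shows "strand a x (strand b x y) = strand (a * b) x y"
proof -
  have "strand a x (strand b x y) = y + pscale (b - 1) (proj x y) +
      pscale (a - 1) (proj x y + pscale (b - 1) (proj x y))"
    by (simp add: strand_def proj_idem[OF assms])
  also have "\<dots> = y + pscale ((b - 1) + (a - 1) + (a - 1) * (b - 1)) (proj x y)"
    by (simp only: lp.scale_left_distrib lp.scale_right_distrib lp.scale_scale add.assoc)
  also have "(b - 1) + (a - 1) + (a - 1) * (b - 1) = a * b - 1" by (simp add: algebra_simps)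
  finally show ?thesis by (simp add: strand_def)
qed

text \<open>One argument for commutation of strands, tensoring, composition and star: each of these
  only has to be compatible with \<open>proj\<close>.\<close>

lemma strand_map:
  assumes "semilinear \<sigma> F" "\<sigma> = cnj \<or> \<sigma> = id" "F (proj x y) = proj x' (F y)"
  shows "F (strand a x y) = strand (\<sigma> a) x' (F y)"
proof -
  have "\<sigma> (a - 1) = \<sigma> a - 1" using assms(2) by auto
  then show ?thesis
    by (simp add: strand_def semilinear_add[OF assms(1)] semilinear_scale[OF assms(1)] assms(3))
qed

lemma strand_commute:
  assumes "y \<in> Part k l" "x \<in> points k l" "x' \<in> points k l"
  shows "strand a x (strand b x' y) = strand b x' (strand a x y)"
  by (intro strand_map[where \<sigma> = id and F = "strand a x", simplified] linear_strand)
    (simp add: strand_def proj_commute[OF assms])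

section \<open>Operators on whole rows, and conjugation of morphisms\<close>

primrec row :: "(nat \<Rightarrow> point) \<Rightarrow> (nat \<Rightarrow> complex) \<Rightarrow> nat \<Rightarrow> lpart \<Rightarrow> lpart" where
  "row P a 0 y = y"
| "row P a (Suc n) y = strand (a (Suc n)) (P (Suc n)) (row P a n y)"

lemma linear_row: "semilinear id (row P a n)"
proof (induction n)
  case 0
  then show ?case by (simp add: semilinear_def)
next
  case (Suc n)
  then show ?case using linear_compose_left[OF linear_strand Suc] by simp
qed

lemma row_Part:
  assumes "y \<in> Part k l" "\<And>j. 1 \<le> j \<Longrightarrow> j \<le> n \<Longrightarrow> P j \<in> points k l"
  shows "row P a n y \<in> Part k l"
  using assms(2) by (induction n) (simp_all add: assms(1) strand_Part)

lemma row_1: "row P (\<lambda>_. 1) n y = y"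
  by (induction n) simp_all

lemma strand_row:
  assumes "y \<in> Part k l" "\<And>j. 1 \<le> j \<Longrightarrow> j \<le> n \<Longrightarrow> P j \<in> points k l" "x \<in> points k l"
  shows "strand b x (row P a n y) = row P a n (strand b x y)"
  using assms(2)
proof (induction n)
  case (Suc n)
  have "row P a n y \<in> Part k l" using Suc.prems by (intro row_Part assms(1)) simp
  then show ?case
    using Suc assms(3) strand_commute[of "row P a n y" k l x "P (Suc n)" b "a (Suc n)"] by simp
qed simp

lemma row_mult:
  assumes "y \<in> Part k l" "\<And>j. 1 \<le> j \<Longrightarrow> j \<le> n \<Longrightarrow> P j \<in> points k l"
  shows "row P a n (row P b n y) = row P (\<lambda>j. a j * b j) n y"
  using assms(2)
proof (induction n)
  case (Suc n)
  have P: "P j \<in> points k l" if "1 \<le> j" "j \<le> n" for j using Suc.prems that by simp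
  have "row P a n (strand (b (Suc n)) (P (Suc n)) (row P b n y)) =
      strand (b (Suc n)) (P (Suc n)) (row P a n (row P b n y))"
    using strand_row[OF row_Part[OF assms(1) P] P] Suc.prems by simp
  moreover have "row P (\<lambda>j. a j * b j) n y \<in> Part k l" using P by (intro row_Part assms(1))
  ultimately show ?case using Suc P by (simp add: strand_strand)
qed simp

lemma row_map:
  assumes "y \<in> Part k l" "\<And>j. 1 \<le> j \<Longrightarrow> j \<le> n \<Longrightarrow> P j \<in> points k l"
    and "semilinear \<sigma> F" "\<sigma> = cnj \<or> \<sigma> = id"
    and "\<And>j z. 1 \<le> j \<Longrightarrow> j \<le> n \<Longrightarrow> z \<in> Part k l \<Longrightarrow> F (proj (P j) z) = proj (P' j) (F z)"
  shows "F (row P a n y) = row P' (\<lambda>j. \<sigma> (a j)) n (F y)"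
  using assms(2,5)
proof (induction n)
  case (Suc n)
  have "row P a n y \<in> Part k l" using Suc.prems by (intro row_Part assms(1)) simp
  then show ?case using Suc strand_map[OF assms(3,4)] by simp
qed simp

lemma row_row:
  assumes "y \<in> Part k l" "\<And>j. 1 \<le> j \<Longrightarrow> j \<le> n \<Longrightarrow> P j \<in> points k l"
    "\<And>j. 1 \<le> j \<Longrightarrow> j \<le> m \<Longrightarrow> Q j \<in> points k l"
  shows "row P a n (row Q b m y) = row Q b m (row P a n y)"
  using assms(2)
proof (induction n)
  case (Suc n)
  have "row P a n y \<in> Part k l" using Suc.prems by (intro row_Part assms(1)) simp
  then show ?case using Suc assms(3) by (simp add: strand_row)
qed simp

text \<open>The rows of a tensor product split at the end of the left factor; the remaining strands
  see their coefficients with an offset.\<close>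

lemma row_add: "row P a (n + m) y = row (\<lambda>j. P (n + j)) (\<lambda>j. a (n + j)) m (row P a n y)"
  by (induction m) simp_all

text \<open>If \<open>a\<close> and \<open>b\<close> are pointwise inverse, this is conjugation by
  the tensor product of the strand operators with parameters \<open>b j\<close>.\<close>

definition act :: "(nat \<Rightarrow> complex) \<Rightarrow> (nat \<Rightarrow> complex) \<Rightarrow> nat \<Rightarrow> nat \<Rightarrow> lpart \<Rightarrow> lpart" where
  "act a b k l y = row Lower b l (row Upper a k y)"

lemma linear_act: "semilinear id (act a b k l)"
  unfolding act_def by (intro linear_compose_left[OF linear_row] linear_row)

lemma act_Part: "y \<in> Part k l \<Longrightarrow> act a b k l y \<in> Part k l"
  unfolding act_def by (intro row_Part) simp_all

lemma act_act:
  assumes y: "y \<in> Part k l"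
  shows "act a b k l (act a' b' k l y) = act (\<lambda>j. a j * a' j) (\<lambda>j. b j * b' j) k l y"
proof -
  \<comment> \<open>Operators on different rows commute, so the two upper passes can be brought
    together.\<close>
  have "row Upper a k (row Lower b' l (row Upper a' k y)) =
      row Lower b' l (row Upper a k (row Upper a' k y))"
    using y by (intro row_row row_Part) simp_all
  moreover have "row Upper a k (row Upper a' k y) = row Upper (\<lambda>j. a j * a' j) k y"
    using y by (intro row_mult) simp_all
  moreover have "row Lower b l (row Lower b' l (row Upper (\<lambda>j. a j * a' j) k y)) =
      row Lower (\<lambda>j. b j * b' j) l (row Upper (\<lambda>j. a j * a' j) k y)"
    using y by (intro row_mult row_Part) simp_all
  ultimately show ?thesis by (simp add: act_def)
qed

text \<open>The left factor absorbs the first \<open>k\<close> upper and \<open>l\<close> lower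
  strands. The right factor sees coefficients shifted by \<open>k\<close> and \<open>l\<close>,
  which is why the parities of \<open>k\<close> and \<open>l\<close> matter for alternating
  coefficients.\<close>

lemma act_tensor:
  assumes x: "x \<in> Part k l" and y: "y \<in> Part k' l'"
  shows "act a b (k + k') (l + l') (tensor k l x y) =
    tensor k l (act a b k l x) (act (\<lambda>j. a (k + j)) (\<lambda>j. b (l + j)) k' l' y)"
proof -
  let ?a = "\<lambda>j. a (k + j)" and ?b = "\<lambda>j. b (l + j)"
  note L = linear_tensor(1) and R = linear_tensor(2)
  have u: "row Upper a k x \<in> Part k l" "row Upper ?a k' y \<in> Part k' l'"
    using x y by (intro row_Part; simp)+
  have 1: "row Upper a k (tensor k l x y) = tensor k l (row Upper a k x) y"
    using row_map[where n = k and P' = Upper and a = a, OF x _ L, of Upper] x y by (simp add: proj_tensor_left)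
  have 2: "row (\<lambda>j. Upper (k + j)) ?a k' (tensor k l (row Upper a k x) y) =
      tensor k l (row Upper a k x) (row Upper ?a k' y)"
    using row_map[where n = k' and P' = "\<lambda>j. Upper (k + j)" and a = ?a, OF y _ R, of Upper] u y
    by (simp add: proj_tensor_right)
  have 3: "row Lower b l (tensor k l (row Upper a k x) (row Upper ?a k' y)) =
      tensor k l (row Lower b l (row Upper a k x)) (row Upper ?a k' y)"
    using row_map[where n = l and P' = Lower and a = b, OF u(1) _ L, of Lower] u by (simp add: proj_tensor_left)
  have 4: "row (\<lambda>j. Lower (l + j)) ?b l' (tensor k l (act a b k l x) (row Upper ?a k' y)) =
      tensor k l (act a b k l x) (row Lower ?b l' (row Upper ?a k' y))"
    using row_map[where n = l' and P' = "\<lambda>j. Lower (l + j)" and a = ?b, OF u(2) _ R, of Lower] u act_Part[OF x]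
    by (simp add: proj_tensor_right)
  show ?thesis
    using 1 2 3 4 by (simp add: act_def row_add)
qed

text \<open>Strand by strand, the operators on the upper row of \<open>y\<close> move through the
  middle row by \<open>proj_compose_slide\<close>; each move changes \<open>x\<close>, so
  \<open>x\<close> is generalized in the induction.\<close>

lemma compose_row_slide:
  assumes x: "x \<in> Part k l" and y: "y \<in> Part l m" and "n \<le> l"
  shows "compose_lin \<delta> (row Upper a n y) x = compose_lin \<delta> y (row Lower a n x)"
  using \<open>n \<le> l\<close> x
proof (induction n arbitrary: x)
  case (Suc n)
  have r: "row Upper a n y \<in> Part l m" using Suc.prems by (intro row_Part y) simp
  have s: "strand (a (Suc n)) (Lower (Suc n)) x \<in> Part k l"
    using Suc.prems by (intro strand_Part) simp_all
  have "compose_lin \<delta> (row Upper a (Suc n) y) x =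
      compose_lin \<delta> (row Upper a n y) (strand (a (Suc n)) (Lower (Suc n)) x)"
    using Suc.prems r
    by (simp add: strand_def proj_compose_slide)
  also have "\<dots> = compose_lin \<delta> y (row Lower a n (strand (a (Suc n)) (Lower (Suc n)) x))"
    using Suc s by simp
  also have "row Lower a n (strand (a (Suc n)) (Lower (Suc n)) x) = row Lower a (Suc n) x"
    using Suc.prems by (simp add: strand_row[symmetric])
  finally show ?case .
qed simp

lemma act_compose:
  assumes x: "x \<in> Part k l" and y: "y \<in> Part l m" and ab: "\<And>j. a j * b j = 1"
  shows "act a b k m (compose_lin \<delta> y x) = compose_lin \<delta> (act a b l m y) (act a b k l x)"
proof -
  have u: "row Upper a k x \<in> Part k l" "row Upper a l y \<in> Part l m"
    using x y by (intro row_Part; simp)+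
  have "row Upper a k (compose_lin \<delta> y x) = compose_lin \<delta> y (row Upper a k x)"
    using row_map[where n = k and P' = Upper and a = a, OF x _ linear_compose(2), of Upper] x y
    by (simp add: proj_compose_upper)
  \<comment> \<open>Since \<open>a j * b j = 1\<close>, both may be inserted on the middle row:
    \<open>b\<close> stays with \<open>x\<close>, and \<open>a\<close> slides over to
    \<open>y\<close> next.\<close>
  also have "\<dots> = compose_lin \<delta> y (row Lower a l (row Lower b l (row Upper a k x)))"
    using row_mult[OF u(1), of l Lower a b] by (simp add: ab row_1)
  also have "\<dots> = compose_lin \<delta> (row Upper a l y) (act a b k l x)"
    using compose_row_slide[OF act_Part[OF x] y order_refl] by (simp add: act_def)
  finally have "act a b k m (compose_lin \<delta> y x) =
      row Lower b m (compose_lin \<delta> (row Upper a l y) (act a b k l x))"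
    by (simp add: act_def)
  also have "\<dots> = compose_lin \<delta> (act a b l m y) (act a b k l x)"
    using row_map[where n = m and P = Lower and P' = Lower and a = b and \<sigma> = id
        and F = "\<lambda>y. compose_lin \<delta> y (act a b k l x)", OF u(2) _ linear_compose(1)]
    by (simp add: proj_compose_lower[OF act_Part[OF x]] act_def[of a b l m])
  finally show ?thesis .
qed

text \<open>Reflecting the diagram swaps the rows, so the lower coefficients reappear on top,
  changed by \<open>\<sigma>\<close>.\<close>

lemma act_star:
  assumes \<sigma>: "\<sigma> = cnj \<or> \<sigma> = id" "\<sigma> \<delta> = \<delta>" and x: "x \<in> Part k l"
  shows "star \<sigma> (act a b k l x) = act (\<lambda>j. \<sigma> (b j)) (\<lambda>j. \<sigma> (a j)) l k (star \<sigma> x)"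
proof -
  note S = semilinear_star[OF \<sigma>(1)]
  have u: "row Upper a k x \<in> Part k l" using x by (intro row_Part) simp_all
  have "star \<sigma> (act a b k l x) = row Upper (\<lambda>j. \<sigma> (b j)) l (star \<sigma> (row Upper a k x))"
    using row_map[OF u _ S \<sigma>(1), of l Lower Upper b] by (simp add: act_def proj_star[OF \<sigma>])
  also have "star \<sigma> (row Upper a k x) = row Lower (\<lambda>j. \<sigma> (a j)) k (star \<sigma> x)"
    using row_map[OF x _ S \<sigma>(1), of k Upper Lower a] by (simp add: proj_star[OF \<sigma>])
  also have "row Upper (\<lambda>j. \<sigma> (b j)) l (row Lower (\<lambda>j. \<sigma> (a j)) k (star \<sigma> x)) =
      row Lower (\<lambda>j. \<sigma> (a j)) k (row Upper (\<lambda>j. \<sigma> (b j)) l (star \<sigma> x))"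
    using star_Part[OF x \<sigma>(1)] by (intro row_row) simp_all
  finally show ?thesis by (simp add: act_def)
qed

end

section \<open>Linear categories\<close>

lemma linear_categoryI:
  assumes "\<And>k l. K k l \<subseteq> Part k l" "\<And>k l. 0 \<in> K k l"
    and "\<And>k l x y. x \<in> K k l \<Longrightarrow> y \<in> K k l \<Longrightarrow> x + y \<in> K k l"
    and "\<And>k l c x. x \<in> K k l \<Longrightarrow> pscale c x \<in> K k l"
    and "basis id_part \<in> K 1 1" "basis pair_part \<in> K 0 2"
    and "\<And>k l k' l' x y. x \<in> K k l \<Longrightarrow> y \<in> K k' l' \<Longrightarrow> tensor k l x y \<in> K (k + k') (l + l')"
    and "\<And>k l m x y. x \<in> K k l \<Longrightarrow> y \<in> K l m \<Longrightarrow> compose_lin \<delta> y x \<in> K k m"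
    and "\<And>k l x. x \<in> K k l \<Longrightarrow> star \<sigma> x \<in> K l k"
  shows "linear_category \<sigma> \<delta> K"
  unfolding linear_category_def lp.subspace_def
  by (intro conjI allI ballI) (rule assms; assumption)+

lemma linear_categoryD:
  assumes "linear_category \<sigma> \<delta> K"
  shows "K k l \<subseteq> Part k l" "0 \<in> K k l"
    and "x \<in> K k l \<Longrightarrow> y \<in> K k l \<Longrightarrow> x + y \<in> K k l"
    and "x \<in> K k l \<Longrightarrow> pscale c x \<in> K k l"
    and "basis id_part \<in> K 1 1" "basis pair_part \<in> K 0 2"
    and "x \<in> K k l \<Longrightarrow> y \<in> K k' l' \<Longrightarrow> tensor k l x y \<in> K (k + k') (l + l')"
    and "x \<in> K k l \<Longrightarrow> z \<in> K l m \<Longrightarrow> compose_lin \<delta> z x \<in> K k m"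
    and "x \<in> K k l \<Longrightarrow> star \<sigma> x \<in> K l k"
  using assms unfolding linear_category_def lp.subspace_def by - ((simp; fail) | blast)+

lemma id_part_parts: "id_part \<in> parts 1 1"
  by (auto simp: parts_def partition_on_def points_def id_part_def disjoint_def)

lemma points_2: "points 0 2 = {Lower 1, Lower 2}" "points 2 2 = {Upper 1, Upper 2, Lower 1, Lower 2}"
proof -
  have "{1..2::nat} = {1, 2}" by auto
  then show "points 0 2 = {Lower 1, Lower 2}" "points 2 2 = {Upper 1, Upper 2, Lower 1, Lower 2}"
    by (simp_all only: points_def) auto
qed

lemma pair_part_parts: "pair_part \<in> parts 0 2"
  by (auto simp: parts_def partition_on_def points_2 pair_part_def disjoint_def)

lemma cross_part_parts: "cross_part \<in> parts 2 2"
  by (auto simp: parts_def partition_on_def points_2 cross_part_def disjoint_def)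

section \<open>Partitions whose blocks all have even size\<close>

definition even_cat :: "nat \<Rightarrow> nat \<Rightarrow> lpart set" where
  "even_cat k l = {x \<in> Part k l. \<forall>p\<in>Poly_Mapping.keys x. \<forall>B\<in>p. even (card B)}"

lemma keys_pscale: "Poly_Mapping.keys (pscale c x) \<subseteq> Poly_Mapping.keys x"
  by (auto simp: in_keys_iff)

lemma keys_lin: "Poly_Mapping.keys (lin f x) \<subseteq> (\<Union>p\<in>Poly_Mapping.keys x. Poly_Mapping.keys (f p))"
  unfolding lin_def using keys_sum keys_pscale by fastforce

lemma card_vimage_case_point:
  assumes "inj a" "inj b" "finite X"
  shows "card (case_point a b -` X) = card (a -` X) + card (b -` X)"
proof -
  have "case_point a b -` X = Upper ` (a -` X) \<union> Lower ` (b -` X)"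
  proof (rule set_eqI)
    fix z show "z \<in> case_point a b -` X \<longleftrightarrow> z \<in> Upper ` (a -` X) \<union> Lower ` (b -` X)"
      by (cases z) auto
  qed
  moreover have "card (Upper ` (a -` X)) = card (a -` X)" "card (Lower ` (b -` X)) = card (b -` X)"
    by (auto intro!: card_image inj_onI)
  moreover have "Upper ` (a -` X) \<inter> Lower ` (b -` X) = {}" by auto
  ultimately show ?thesis
    using finite_vimageI[OF assms(3,1)] finite_vimageI[OF assms(3,2)]
    by (simp add: card_Un_disjoint)
qed

text \<open>The preimage of \<open>X\<close> is a disjoint union of blocks of \<open>p\<close>,
  because a block whose image meets \<open>X\<close> is mapped into it.\<close>

lemma even_card_vimage:
  assumes p: "partition_on A p" "finite A" and "\<And>B. B \<in> p \<Longrightarrow> even (card B)"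
    and X: "f -` X \<subseteq> A" "\<And>B. B \<in> p \<Longrightarrow> f ` B \<inter> X \<noteq> {} \<Longrightarrow> f ` B \<subseteq> X"
  shows "even (card (f -` X))"
proof -
  let ?P = "{B \<in> p. f ` B \<subseteq> X}"
  have "f -` X = \<Union>?P"
  proof (intro equalityI subsetI)
    fix z assume z: "z \<in> f -` X"
    then obtain B where "B \<in> p" "z \<in> B" using X(1) partition_onD1[OF p(1)] by blast
    then show "z \<in> \<Union>?P" using X(2)[of B] z by blast
  qed auto
  moreover have "card (\<Union>?P) = sum card ?P"
  proof (rule card_Union_disjoint)
    show "disjoint ?P" using partition_onD2[OF p(1)] by (auto simp: pairwise_def)
    show "finite B" if "B \<in> ?P" for B
      using that partition_onD1[OF p(1)] p(2) by (auto intro: finite_subset)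
  qed
  ultimately show ?thesis using assms(3) by (auto intro!: dvd_sum)
qed

text \<open>A component contains every block of \<open>p\<close> and of \<open>q\<close> that it
  meets, so its number of top plus middle points and its number of middle plus bottom points are
  even. Adding them cancels the middle points modulo two.\<close>

lemma even_comp_part:
  assumes p: "p \<in> parts k l" "\<forall>B\<in>p. even (card B)" and q: "q \<in> parts l m" "\<forall>B\<in>q. even (card B)"
    and B: "B \<in> comp_part q p"
  shows "even (card B)"
proof -
  obtain X where X: "X \<in> components q p" "B = case_point Top Bot -` X"
    using B by (auto simp: comp_part_def)
  have sub: "X \<subseteq> Top ` {1..k} \<union> Mid ` {1..l} \<union> Bot ` {1..m}"
    using partition_onD1[OF partition_on_components[OF p(1) q(1)]] X(1) by blast
  then have fin: "finite X" by (rule finite_subset) simp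
  have block: "C \<subseteq> X" if "C \<in> stacked q p" "C \<inter> X \<noteq> {}" for C
    using comps_block[OF that(1)] X(1) that(2) by (simp add: components_eq_comps)
  have "even (card (case_point Top Mid -` X))"
  proof (rule even_card_vimage[OF _ finite_points[of k l]])
    show "partition_on (points k l) p" using p(1) by (simp add: parts_def)
    show "case_point Top Mid -` X \<subseteq> points k l"
    proof
      fix z assume "z \<in> case_point Top Mid -` X"
      then show "z \<in> points k l" using sub by (cases z) auto
    qed
    show "case_point Top Mid ` B \<subseteq> X" if "B \<in> p" "case_point Top Mid ` B \<inter> X \<noteq> {}" for B
      using block[of "case_point Top Mid ` B"] that by (simp add: stacked_def)
  qed (use p(2) in blast)
  moreover have "even (card (case_point Mid Bot -` X))"
  proof (rule even_card_vimage[OF _ finite_points[of l m]])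
    show "partition_on (points l m) q" using q(1) by (simp add: parts_def)
    show "case_point Mid Bot -` X \<subseteq> points l m"
    proof
      fix z assume "z \<in> case_point Mid Bot -` X"
      then show "z \<in> points l m" using sub by (cases z) auto
    qed
    show "case_point Mid Bot ` B \<subseteq> X" if "B \<in> q" "case_point Mid Bot ` B \<inter> X \<noteq> {}" for B
      using block[of "case_point Mid Bot ` B"] that by (simp add: stacked_def)
  qed (use q(2) in blast)
  ultimately show ?thesis
    unfolding X(2) using card_vimage_case_point[OF _ _ fin] by (auto simp: inj_def)
qed

text \<open>This category separates the two generators: the crossing belongs to it, while the
  generator of \<open>K\<close> has \<open>s_part\<close> among its keys. The operations only
  produce keys obtained from keys of their arguments, so the block sizes are checked on
  partitions.\<close>

lemma linear_category_even_cat: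
  assumes "\<sigma> = cnj \<or> \<sigma> = id"
  shows "linear_category \<sigma> \<delta> even_cat"
proof (rule linear_categoryI, goal_cases)
  case (3 k l x y)
  then show ?case using keys_add[of x y] by (auto simp: even_cat_def Part_add)
next
  case (4 k l c x)
  then show ?case using keys_pscale[of c x] by (auto simp: even_cat_def Part_scale)
next
  case 5
  then show ?case using id_part_parts by (simp add: even_cat_def id_part_def)
next
  case 6
  then show ?case using pair_part_parts by (simp add: even_cat_def pair_part_def)
next
  case (7 k l k' l' x y)
  have "even (card B)" if r: "r \<in> Poly_Mapping.keys (tensor k l x y)" "B \<in> r" for r B
  proof -
    have "Poly_Mapping.keys (tensor k l x y) \<subseteq>
        (\<Union>p\<in>Poly_Mapping.keys x. \<Union>q\<in>Poly_Mapping.keys y. {tensor_part k l p q})"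
      unfolding tensor_eq_lin
      by (rule order_trans[OF keys_lin UN_mono[OF order_refl]],
          rule order_trans[OF keys_lin UN_mono[OF order_refl]]) simp
    then obtain p q where "p \<in> Poly_Mapping.keys x" "q \<in> Poly_Mapping.keys y" "r = tensor_part k l p q"
      using r(1) by blast
    then show ?thesis
      using 7 r(2) card_image[OF inj_on_subset[OF inj_shift_point subset_UNIV]]
      by (auto simp: even_cat_def tensor_part_def)
  qed
  then show ?case using 7 tensor_Part by (simp add: even_cat_def)
next
  case (8 k l m x y)
  have "even (card B)" if r: "r \<in> Poly_Mapping.keys (compose_lin \<delta> y x)" "B \<in> r" for r B
  proof -
    have "Poly_Mapping.keys (compose_lin \<delta> y x) \<subseteq>
        (\<Union>q\<in>Poly_Mapping.keys y. \<Union>p\<in>Poly_Mapping.keys x. {comp_part q p})"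
      unfolding compose_eq_lin
      by (rule order_trans[OF keys_lin UN_mono[OF order_refl]],
          rule order_trans[OF keys_lin UN_mono[OF order_refl]],
          rule order_trans[OF keys_pscale]) simp
    then obtain p q where "p \<in> Poly_Mapping.keys x" "q \<in> Poly_Mapping.keys y" "r = comp_part q p"
      using r(1) by blast
    then show ?thesis
      using 8 r(2) even_comp_part[of p k l q m B] by (auto simp: even_cat_def Part_def)
  qed
  then show ?case using 8 compose_Part[of x k l y m] by (simp add: even_cat_def)
next
  case (9 k l x)
  have "even (card B)" if r: "r \<in> Poly_Mapping.keys (star \<sigma> x)" "B \<in> r" for r B
  proof -
    have "Poly_Mapping.keys (star \<sigma> x) \<subseteq> (\<Union>p\<in>Poly_Mapping.keys x. {star_part p})"
      unfolding star_def by (rule order_trans[OF keys_sum UN_mono[OF order_refl]]) simp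
    then obtain p where "p \<in> Poly_Mapping.keys x" "r = star_part p"
      using r(1) by blast
    then show ?thesis
      using 9 r(2) card_image[OF inj_on_subset[OF inj_flip_point subset_UNIV]]
      by (auto simp: even_cat_def star_part_def)
  qed
  then show ?case using 9 star_Part[OF _ assms] by (simp add: even_cat_def)
qed (auto simp: even_cat_def)

section \<open>The isomorphism\<close>

text \<open>The generator of \<open>K\<close>: the crossing with \<open>\<tau>\<close> on each of
  its two strings, expanded.\<close>

definition twist :: "complex \<Rightarrow> lpart" where
  "twist \<delta> = basis cross_part - pscale (2 / \<delta>) (basis r1_part + basis r2_part)
    + pscale (4 / \<delta>\<^sup>2) (basis s_part)"

text \<open>The parameters of \<open>\<rho>\<close> on odd strands and of its inverse on even
  strands. Alternation makes neighbouring parameters multiply to \<open>1\<close>, as the pair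
  partition demands; the squares are \<open>- 1\<close>, the parameter of
  \<open>\<tau>\<close>.\<close>

definition rot :: "nat \<Rightarrow> complex" where
  "rot j = (if odd j then \<i> else - \<i>)"

lemma rot_square [simp]: "rot j * rot j = - 1"
  by (simp add: rot_def)

context nonzero_loop
begin

abbreviation reflect :: "nat \<Rightarrow> nat \<Rightarrow> lpart \<Rightarrow> lpart" where
  "reflect \<equiv> act (\<lambda>_. - 1) (\<lambda>_. - 1)"

text \<open>
  For \<open>k + l\<close> even, tensoring with a morphism from \<open>k\<close> to \<open>l\<close> points on the left shifts the upper and
  the lower row of the right factor by the same parity.
\<close>

definition fixed :: "nat \<Rightarrow> nat \<Rightarrow> lpart set" where
  "fixed k l = {x \<in> Part k l. reflect k l x = x \<and> (odd (k + l) \<longrightarrow> x = 0)}"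

text \<open>Since \<open>rot j\<close> squares to \<open>- 1\<close>, its inverse is
  \<open>- rot j\<close>; so this is a conjugation with the inverse on the upper row.\<close>

definition \<Phi> :: "nat \<Rightarrow> nat \<Rightarrow> lpart \<Rightarrow> lpart" where
  "\<Phi> = act (\<lambda>j. - rot j) rot"

lemma fixedD: "x \<in> fixed k l \<Longrightarrow> x \<in> Part k l" "x \<in> fixed k l \<Longrightarrow> reflect k l x = x"
  "x \<in> fixed k l \<Longrightarrow> odd (k + l) \<Longrightarrow> x = 0"
  by (simp_all add: fixed_def)

text \<open>Cutting a two-point block at either end leaves the same two singletons with the same
  factor \<open>1 / \<delta>\<close>, so an operator may move along a string.\<close>

lemma strand_pair:
  assumes "partition_on A p" "{x, y} \<in> p" "x \<noteq> y"
  shows "strand a x (basis p) = strand a y (basis p)"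
proof -
  have other: "x \<notin> B \<and> y \<notin> B" if "B \<in> p - {{x, y}}" for B
    using disjointD[OF partition_onD2[OF assms(1)] _ assms(2), of B] that by blast
  have p: "p = {{x, y}} \<union> (p - {{x, y}})" using assms(2) by blast
  have E: "{} \<notin> p - {{x, y}}" using partition_onD3[OF assms(1)] by simp
  have "isolate x p = isolate x {{x, y}} \<union> (p - {{x, y}})"
    "isolate y p = isolate y {{x, y}} \<union> (p - {{x, y}})"
    using isolate_Un_disjoint[OF _ E, of _ "{{x, y}}"] other p by auto
  moreover have "isolate x {{x, y}} = isolate y {{x, y}}"
    using assms(3) by (auto simp: isolate_def)
  moreover have "{x} \<notin> p" "{y} \<notin> p" using other assms(3) by blast+
  ultimately show ?thesis by (simp add: strand_def proj_basis iso_coeff_def)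
qed

text \<open>Both operators are moved to the lower end of the string, where their parameters multiply
  to \<open>1\<close>.\<close>

lemma act_id_part:
  assumes "a 1 * b 1 = 1"
  shows "act a b 1 1 (basis id_part) = basis id_part"
proof -
  have p: "partition_on (points 1 1) id_part" using id_part_parts by (simp add: parts_def)
  have "strand (a 1) (Upper 1) (basis id_part) = strand (a 1) (Lower 1) (basis id_part)"
    by (rule strand_pair[OF p]) (simp_all add: id_part_def)
  then show ?thesis
    using strand_strand[of "basis id_part" 1 1 "Lower 1" "b 1" "a 1"] id_part_parts assms
    by (simp add: act_def mult.commute)
qed

lemma act_pair_part:
  assumes "b 1 * b 2 = 1"
  shows "act a b 0 2 (basis pair_part) = basis pair_part"
proof -
  have p: "partition_on (points 0 2) pair_part" using pair_part_parts by (simp add: parts_def)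
  have "strand (b 1) (Lower 1) (basis pair_part) = strand (b 1) (Lower 2) (basis pair_part)"
    by (rule strand_pair[OF p]) (simp_all add: pair_part_def)
  then show ?thesis
    using strand_strand[of "basis pair_part" 0 2 "Lower 2" "b 2" "b 1"] pair_part_parts assms
    by (simp add: act_def mult.commute numeral_2_eq_2)
qed

text \<open>The strings join \<open>Upper 1\<close> to \<open>Lower 2\<close> and
  \<open>Upper 2\<close> to \<open>Lower 1\<close>. Moving the upper operators down their strings
  combines \<open>a 1\<close> with \<open>b 2\<close> and \<open>a 2\<close> with
  \<open>b 1\<close>.\<close>

lemma act_cross_part:
  "act a b 2 2 (basis cross_part) =
    strand (b 2 * a 1) (Lower 2) (strand (b 1 * a 2) (Lower 1) (basis cross_part))"
proof -
  let ?c = "basis cross_part"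
  have c: "?c \<in> Part 2 2" using cross_part_parts by simp
  have p: "partition_on (points 2 2) cross_part" using cross_part_parts by (simp add: parts_def)
  have 1: "strand (a 1) (Upper 1) ?c = strand (a 1) (Lower 2) ?c"
    and 2: "strand (a 2) (Upper 2) ?c = strand (a 2) (Lower 1) ?c"
    by (rule strand_pair[OF p]; simp add: cross_part_def)+
  have "act a b 2 2 ?c = strand (b 2) (Lower 2) (strand (b 1) (Lower 1)
      (strand (a 2) (Upper 2) (strand (a 1) (Upper 1) ?c)))"
    by (simp add: act_def numeral_2_eq_2)
  also have "strand (a 2) (Upper 2) (strand (a 1) (Upper 1) ?c) =
      strand (a 1) (Lower 2) (strand (a 2) (Lower 1) ?c)"
    unfolding 1 2[symmetric] by (rule strand_commute[OF c]) simp_all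
  also have "strand (b 1) (Lower 1) (strand (a 1) (Lower 2) (strand (a 2) (Lower 1) ?c)) =
      strand (a 1) (Lower 2) (strand (b 1) (Lower 1) (strand (a 2) (Lower 1) ?c))"
    by (rule strand_commute[OF strand_Part[OF c]]) simp_all
  also have "strand (b 1) (Lower 1) (strand (a 2) (Lower 1) ?c) = strand (b 1 * a 2) (Lower 1) ?c"
    by (rule strand_strand[OF c]) simp
  also have "strand (b 2) (Lower 2) (strand (a 1) (Lower 2) (strand (b 1 * a 2) (Lower 1) ?c)) =
      strand (b 2 * a 1) (Lower 2) (strand (b 1 * a 2) (Lower 1) ?c)"
    by (rule strand_strand[OF strand_Part[OF c]]) simp_all
  finally show ?thesis .
qed

lemma \<Phi>_cross: "\<Phi> 2 2 (basis cross_part) = twist \<delta>"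
proof -
  \<comment> \<open>Cutting the crossing at the lower end of one string gives \<open>r1_part\<close>
    or \<open>r2_part\<close>, cutting both gives \<open>s_part\<close>; each cut costs
    \<open>1 / \<delta>\<close>.\<close>
  have "isolate (Lower 1) cross_part = r1_part" "isolate (Lower 2) cross_part = r2_part"
    "isolate (Lower 2) r1_part = s_part"
    unfolding isolate_def cross_part_def r1_part_def r2_part_def s_part_def
    by (simp_all add: insert_Diff_if insert_commute)
  moreover have "iso_coeff \<delta> (Lower 1) cross_part = 1 / \<delta>" "iso_coeff \<delta> (Lower 2) cross_part = 1 / \<delta>"
    "iso_coeff \<delta> (Lower 2) r1_part = 1 / \<delta>"
    by (simp_all add: iso_coeff_def cross_part_def r1_part_def doubleton_eq_iff)
  ultimately have P: "proj (Lower 1) (basis cross_part) = pscale (1 / \<delta>) (basis r1_part)"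
    "proj (Lower 2) (basis cross_part) = pscale (1 / \<delta>) (basis r2_part)"
    "proj (Lower 2) (basis r1_part) = pscale (1 / \<delta>) (basis s_part)"
    by (simp_all add: proj_basis)
  \<comment> \<open>Each string joins positions of opposite parity, so its parameters do not cancel:
    \<open>rot 2 * (- rot 1)\<close> and \<open>rot 1 * (- rot 2)\<close> are both
    \<open>- 1\<close>, which puts \<open>\<tau>\<close> on each string.\<close>
  have "\<Phi> 2 2 (basis cross_part) = strand (- 1) (Lower 2) (strand (- 1) (Lower 1) (basis cross_part))"
    unfolding \<Phi>_def act_cross_part by (simp add: rot_def)
  also have "\<dots> = twist \<delta>"
  proof -
    have s: "strand (- 1) z y = y + pscale (- 2) (proj z y)" for z y by (simp add: strand_def)
    have "strand (- 1) (Lower 2) (strand (- 1) (Lower 1) (basis cross_part)) =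
        basis cross_part + pscale (- 2) (pscale (1 / \<delta>) (basis r1_part)) +
        pscale (- 2) (pscale (1 / \<delta>) (basis r2_part) +
          pscale (- 2) (pscale (1 / \<delta>) (pscale (1 / \<delta>) (basis s_part))))"
      by (simp only: s P proj_simps)
    also have "\<dots> = twist \<delta>"
      unfolding twist_def
      by (rule poly_mapping_eqI) (simp add: lookup_add lookup_minus algebra_simps power2_eq_square)
    finally show ?thesis .
  qed
  finally show ?thesis .
qed

text \<open>The reflection uses \<open>- 1\<close>, its own inverse, so it respects composition;
  being constant along the rows, it also respects tensor products. A tensor product or composite of
  odd total parity has a factor of odd parity, which is zero.\<close>

lemma linear_category_fixed:
  assumes "\<sigma> = cnj \<or> \<sigma> = id" "\<sigma> \<delta> = \<delta>"
  shows "linear_category \<sigma> \<delta> fixed"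
proof (rule linear_categoryI, goal_cases)
  case (2 k l)
  then show ?case using semilinear_0[OF linear_act] by (simp add: fixed_def)
next
  case (3 k l x y)
  then show ?case using semilinear_add[OF linear_act] by (auto simp: fixed_def Part_add)
next
  case (4 k l c x)
  then show ?case using semilinear_scale[OF linear_act] by (auto simp: fixed_def Part_scale)
next
  case 5
  then show ?case using act_id_part id_part_parts by (simp add: fixed_def)
next
  case 6
  then show ?case using act_pair_part pair_part_parts by (simp add: fixed_def)
next
  case (7 k l k' l' x y)
  then have "tensor k l x y = 0" if "odd (k + k' + (l + l'))"
    using that fixedD(3)[OF 7(1)] fixedD(3)[OF 7(2)] linear_tensor[THEN semilinear_0]
    by (cases "odd (k + l)") auto
  then show ?case using 7 by (simp add: fixed_def tensor_Part act_tensor)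
next
  case (8 k l m x y)
  then have "compose_lin \<delta> y x = 0" if "odd (k + m)"
    using that fixedD(3)[OF 8(1)] fixedD(3)[OF 8(2)] linear_compose[THEN semilinear_0]
    by (cases "odd (k + l)") auto
  then show ?case using 8 act_compose[of x k l y m "\<lambda>_. - 1" "\<lambda>_. - 1"]
      compose_Part[OF fixedD(1)[OF 8(1)] fixedD(1)[OF 8(2)]]
    by (simp add: fixed_def)
next
  case (9 k l x)
  have "\<sigma> (- 1) = - 1" using assms(1) by auto
  then have "reflect l k (star \<sigma> x) = star \<sigma> (reflect k l x)"
    using 9 by (simp add: act_star[OF assms fixedD(1)])
  then show ?case
    using 9 star_Part[OF _ assms(1)] semilinear_0[OF semilinear_star[OF assms(1)]]
    by (auto simp: fixed_def add.commute)
qed (auto simp: fixed_def)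

section \<open>Compatibility of \<open>\<Phi>\<close> with the category operations\<close>

lemma \<Phi>_fixed:
  assumes "x \<in> fixed k l"
  shows "\<Phi> k l x \<in> fixed k l"
proof -
  have "reflect k l (\<Phi> k l x) = \<Phi> k l (reflect k l x)"
    using fixedD(1)[OF assms] by (simp add: \<Phi>_def act_act)
  then show ?thesis
    using assms semilinear_0[OF linear_act] by (auto simp: fixed_def \<Phi>_def act_Part)
qed

text \<open>Applying \<open>\<Phi>\<close> twice squares the parameters to \<open>- 1\<close>, which
  gives the reflection, trivial on \<open>fixed\<close>.\<close>

lemma \<Phi>_\<Phi>: "x \<in> fixed k l \<Longrightarrow> \<Phi> k l (\<Phi> k l x) = x"
  by (simp add: fixed_def \<Phi>_def act_act)

text \<open>The inverse parameters differ from those of \<open>\<Phi>\<close> by the sign that the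
  reflection supplies. Thus \<open>\<Phi>\<close> agrees with its inverse, which is what appears
  when positions shift by an odd number or a linear involution exchanges the rows.\<close>

lemma act_rot: "x \<in> fixed k l \<Longrightarrow> act rot (\<lambda>j. - rot j) k l x = \<Phi> k l x"
  using act_act[of x k l "\<lambda>j. - rot j" rot "\<lambda>_. - 1" "\<lambda>_. - 1"] by (simp add: fixed_def \<Phi>_def)

lemma \<Phi>_tensor:
  assumes x: "x \<in> fixed k l" and y: "y \<in> fixed k' l'"
  shows "\<Phi> (k + k') (l + l') (tensor k l x y) = tensor k l (\<Phi> k l x) (\<Phi> k' l' y)"
proof (cases "odd (k + l)")
  case True
  then show ?thesis
    using fixedD(3)[OF x] linear_tensor(1)[THEN semilinear_0] semilinear_0[OF linear_act]
    by (simp add: \<Phi>_def)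
next
  case False
  \<comment> \<open>Here \<open>k\<close> and \<open>l\<close> have equal parity, so both rows of
    the right factor change sign together; in the odd case the result is the inverse of
    \<open>\<Phi>\<close>, covered by \<open>act_rot\<close>.\<close>
  have "rot (k + j) = (if even k then rot j else - rot j)" "rot (l + j) = (if even k then rot j else - rot j)" for j
    using False by (auto simp: rot_def)
  then show ?thesis
    using act_rot[OF y] act_tensor[OF fixedD(1)[OF x] fixedD(1)[OF y], of "\<lambda>j. - rot j" rot]
    by (cases "even k") (simp_all add: \<Phi>_def)
qed

lemma \<Phi>_compose:
  assumes "x \<in> Part k l" "y \<in> Part l m"
  shows "\<Phi> k m (compose_lin \<delta> y x) = compose_lin \<delta> (\<Phi> l m y) (\<Phi> k l x)"
  unfolding \<Phi>_def using assms by (rule act_compose) simp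

lemma \<Phi>_star:
  assumes "\<sigma> = cnj \<or> \<sigma> = id" "\<sigma> \<delta> = \<delta>" and x: "x \<in> fixed k l"
  shows "\<Phi> l k (star \<sigma> x) = star \<sigma> (\<Phi> k l x)"
proof -
  have f: "star \<sigma> x \<in> fixed l k" using linear_categoryD(9)[OF linear_category_fixed[OF assms(1,2)] x] .
  have "star \<sigma> (\<Phi> k l x) = act (\<lambda>j. \<sigma> (rot j)) (\<lambda>j. \<sigma> (- rot j)) l k (star \<sigma> x)"
    unfolding \<Phi>_def by (rule act_star[OF assms(1,2) fixedD(1)[OF x]])
  also have "\<dots> = \<Phi> l k (star \<sigma> x)"
  \<comment> \<open>Exchanging the rows turns the parameters into their inverses; complex
    conjugation undoes this, and for the linear involution \<open>act_rot\<close> does.\<close>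
  proof (cases "\<sigma> = cnj")
    case True
    then have "\<sigma> (rot j) = - rot j" "\<sigma> (- rot j) = rot j" for j by (auto simp: rot_def)
    then show ?thesis by (simp add: \<Phi>_def)
  next
    case False
    then show ?thesis using assms(1) act_rot[OF f] by simp
  qed
  finally show ?thesis by simp
qed

text \<open>Pulling a category back along \<open>\<Phi>\<close> makes the minimality of a generated
  category applicable to the pullback.\<close>

lemma linear_category_\<Phi>_vimage:
  assumes \<sigma>: "\<sigma> = cnj \<or> \<sigma> = id" "\<sigma> \<delta> = \<delta>" and K: "linear_category \<sigma> \<delta> K"
  shows "linear_category \<sigma> \<delta> (\<lambda>k l. {x \<in> fixed k l. \<Phi> k l x \<in> K k l})"
proof -
  note F = linear_categoryD[OF linear_category_fixed[OF \<sigma>]] and K = linear_categoryD[OF K]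
  have L: "semilinear id (\<Phi> k l)" for k l by (simp add: \<Phi>_def linear_act)
  have "\<Phi> 1 1 (basis id_part) = basis id_part" "\<Phi> 0 2 (basis pair_part) = basis pair_part"
    unfolding \<Phi>_def by (rule act_id_part act_pair_part; simp add: rot_def)+
  note base = this
  show ?thesis
  proof (rule linear_categoryI, goal_cases)
    case (8 k l m x y)
    then show ?case using F(8)[of x k l y m] K(8)[of "\<Phi> k l x" k l "\<Phi> l m y" m] \<Phi>_compose[of x k l y m] fixedD(1) by simp
  qed (use F(1) base F(5,6) K(5,6) in \<open>auto simp: F(2-4,7,9) K(2-4,7,9) semilinear_0[OF L]
      semilinear_add[OF L] semilinear_scale[OF L] \<Phi>_tensor \<Phi>_star[OF \<sigma>]\<close>)
qed

text \<open>\<open>fixed\<close> is itself a category containing \<open>x0\<close>. Each category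
  containing the image of \<open>x0\<close> pulls back to one containing \<open>x0\<close>, hence
  \<open>x\<close>.\<close>

lemma \<Phi>_generated:
  assumes \<sigma>: "\<sigma> = cnj \<or> \<sigma> = id" "\<sigma> \<delta> = \<delta>" and x0: "x0 \<in> fixed a b"
    and x: "x \<in> generated \<sigma> \<delta> {(a, b, x0)} k l"
  shows "x \<in> fixed k l" "\<Phi> k l x \<in> generated \<sigma> \<delta> {(a, b, \<Phi> a b x0)} k l"
proof -
  show "x \<in> fixed k l"
    using x x0 linear_category_fixed[OF \<sigma>] unfolding generated_def by blast
  show "\<Phi> k l x \<in> generated \<sigma> \<delta> {(a, b, \<Phi> a b x0)} k l"
    unfolding generated_def
  proof clarify
    fix K assume "linear_category \<sigma> \<delta> K" "\<forall>(a', b', y)\<in>{(a, b, \<Phi> a b x0)}. y \<in> K a' b'"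
    then have "linear_category \<sigma> \<delta> (\<lambda>k l. {x \<in> fixed k l. \<Phi> k l x \<in> K k l})"
      "x0 \<in> {x \<in> fixed a b. \<Phi> a b x \<in> K a b}"
      using linear_category_\<Phi>_vimage[OF \<sigma>] x0 by auto
    then have "x \<in> {x \<in> fixed k l. \<Phi> k l x \<in> K k l}"
      using x unfolding generated_def by blast
    then show "\<Phi> k l x \<in> K k l" by simp
  qed
qed

lemma isomorphic_twist:
  assumes \<sigma>: "\<sigma> = cnj \<or> \<sigma> = id" "\<sigma> \<delta> = \<delta>"
  shows "isomorphic \<sigma> \<delta> (generated \<sigma> \<delta> {(2, 2, twist \<delta>)}) (generated \<sigma> \<delta> {(2, 2, basis cross_part)})"
    and "basis cross_part \<notin> generated \<sigma> \<delta> {(2, 2, twist \<delta>)} 2 2"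
proof -
  let ?K = "generated \<sigma> \<delta> {(2, 2, twist \<delta>)}" and ?L = "generated \<sigma> \<delta> {(2, 2, basis cross_part)}"
  \<comment> \<open>On each string of the crossing the two reflection parameters multiply to
    \<open>1\<close>.\<close>
  have c: "basis cross_part \<in> fixed 2 2"
    using cross_part_parts by (simp add: fixed_def act_cross_part)
  \<comment> \<open>As an involution on \<open>fixed\<close>, \<open>\<Phi>\<close> also sends the
    generator of \<open>K\<close> back to the crossing.\<close>
  have t: "twist \<delta> \<in> fixed 2 2" "\<Phi> 2 2 (twist \<delta>) = basis cross_part"
    using \<Phi>_fixed[OF c] \<Phi>_\<Phi>[OF c] by (simp_all add: \<Phi>_cross)
  have K: "x \<in> fixed k l" "\<Phi> k l x \<in> ?L k l" if "x \<in> ?K k l" for x k l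
    using \<Phi>_generated[OF \<sigma> t(1) that] by (simp_all add: t(2))
  have L: "x \<in> fixed k l" "\<Phi> k l x \<in> ?K k l" if "x \<in> ?L k l" for x k l
    using \<Phi>_generated[OF \<sigma> c that] by (simp_all add: \<Phi>_cross)
  have lin: "semilinear id (\<Phi> k l)" for k l by (simp add: \<Phi>_def linear_act)
  have "bij_betw (\<Phi> k l) (?K k l) (?L k l)" for k l
    by (rule bij_betw_byWitness[where f' = "\<Phi> k l"]) (use K L \<Phi>_\<Phi> in auto)
  then have "monoidal_star_iso \<sigma> \<delta> ?K ?L \<Phi>"
    unfolding monoidal_star_iso_def
    using K(1) semilinear_add[OF lin] semilinear_scale[OF lin] \<Phi>_tensor
      \<Phi>_compose[OF fixedD(1) fixedD(1)] \<Phi>_star[OF \<sigma>]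
    by simp
  then show "isomorphic \<sigma> \<delta> ?K ?L" unfolding isomorphic_def by blast
  show "basis cross_part \<notin> ?K 2 2"
  proof
    assume "basis cross_part \<in> ?K 2 2"
    then have "twist \<delta> \<in> ?L 2 2" using K(2) \<Phi>_cross by metis
    moreover have "basis cross_part \<in> even_cat 2 2"
      using cross_part_parts by (auto simp: even_cat_def cross_part_def)
    ultimately have "twist \<delta> \<in> even_cat 2 2"
      using linear_category_even_cat[OF \<sigma>(1), of \<delta>] unfolding generated_def by blast
    \<comment> \<open>The partition into singletons differs from the three others, so nothing
      interferes with its coefficient \<open>4 / \<delta>\<^sup>2\<close>, which is nonzero; its
      blocks have odd size.\<close>
    moreover have "{Upper 1, Lower 2} \<notin> s_part" "{Upper 2, Lower 1} \<notin> s_part"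
      by (simp_all add: s_part_def)
    then have "cross_part \<noteq> s_part" "r1_part \<noteq> s_part" "r2_part \<noteq> s_part"
      by (auto simp: cross_part_def r1_part_def r2_part_def)
    then have "Poly_Mapping.lookup (twist \<delta>) s_part = 4 / \<delta>\<^sup>2"
      by (simp add: twist_def lookup_add lookup_minus lookup_single when_def)
    then have "s_part \<in> Poly_Mapping.keys (twist \<delta>)" using \<delta> by (simp add: in_keys_iff)
    moreover have "{Upper 1} \<in> s_part" by (simp add: s_part_def)
    ultimately have "even (card {Upper 1})" unfolding even_cat_def by blast
    then show False by simp
  qed
qed

end

theorem proposition6p6:
  fixes \<delta> :: complex and \<sigma> :: "complex \<Rightarrow> complex" and K :: "nat \<Rightarrow> nat \<Rightarrow> lpart set"
  assumes "\<delta> \<noteq> 0"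
    and "\<sigma> = cnj \<or> \<sigma> = id" and "\<sigma> \<delta> = \<delta>"
    and "K = generated \<sigma> \<delta> {(2, 2,
      basis cross_part - pscale (2 / \<delta>) (basis r1_part + basis r2_part)
        + pscale (4 / \<delta>\<^sup>2) (basis s_part))}"
  shows "isomorphic \<sigma> \<delta> K (generated \<sigma> \<delta> {(2, 2, basis cross_part)}) \<and> \<not> easy K"
proof -
  interpret nonzero_loop \<delta> by unfold_locales (rule assms(1))
  have K: "K = generated \<sigma> \<delta> {(2, 2, twist \<delta>)}" using assms(4) by (simp only: twist_def)
  have "\<not> easy K"
  proof
    assume "easy K"
    then obtain C where C: "K 2 2 = lp.span (basis ` C)" unfolding easy_def by blast
    have "twist \<delta> \<in> K 2 2" unfolding K generated_def by blast
    \<comment> \<open>A partition with nonzero coefficient in an element of \<open>K 2 2\<close>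
      must lie in the spanning set \<open>C\<close>.\<close>
    moreover have "lp.span (basis ` C) \<subseteq> {x. Poly_Mapping.keys x \<subseteq> C}"
    proof (rule lp.span_minimal)
      have "Poly_Mapping.keys (x + y) \<subseteq> C"
        if "Poly_Mapping.keys x \<subseteq> C" "Poly_Mapping.keys y \<subseteq> C" for x y :: lpart
        using keys_add[of x y] that by blast
      moreover have "Poly_Mapping.keys (pscale c x) \<subseteq> C" if "Poly_Mapping.keys x \<subseteq> C" for c x
        using keys_pscale[of c x] that by blast
      ultimately show "lp.subspace {x. Poly_Mapping.keys x \<subseteq> C}" by (simp add: lp.subspace_def)
    qed auto
    \<comment> \<open>The crossing has coefficient \<open>1\<close> in the generator, so it would
      itself lie in \<open>C\<close> and hence in \<open>K\<close>.\<close>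
    moreover have "cross_part \<noteq> r1_part" "cross_part \<noteq> r2_part" "cross_part \<noteq> s_part"
      by (auto simp: cross_part_def r1_part_def r2_part_def s_part_def doubleton_eq_iff)
    then have "Poly_Mapping.lookup (twist \<delta>) cross_part = 1"
      by (simp add: twist_def lookup_add lookup_minus lookup_single when_def)
    then have "cross_part \<in> Poly_Mapping.keys (twist \<delta>)" by (simp add: in_keys_iff)
    ultimately have "cross_part \<in> C" using C by blast
    then have "basis cross_part \<in> K 2 2" using C lp.span_base[of "basis cross_part" "basis ` C"] by simp
    then show False using isomorphic_twist(2)[OF assms(2,3)] K by simp
  qed
  then show ?thesis using isomorphic_twist(1)[OF assms(2,3)] K by simp
qed

end
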